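(* Let $N\ge1$, $0<s<1$, and let $G$ be an Orlicz function satisfying hypothesis (H) below, with $p=\mathrm{index}(G)$. Let $u\in L^G(\mathbb{R}^N)$. If \begin{equation*} \liminf_{\delta\to 0^+}\frac{1}{G(\delta^{1-s})}\int_{\mathbb{R}^N}\int_{B(x,\delta)}G\left(\frac{|u(x)-u(y)|}{|x-y|^{s}}\right)\frac{dy\,dx}{|x-y|^N}<\infty, \end{equation*} then $u\in W^{1,p}(\mathbb{R}^N)$.
   Context: An Orlicz function is a function $G:[0,\infty)\to[0,\infty)$ that is continuous, convex, increasing, with $G(0)=0$, satisfies the $\Delta_2$ condition ($G(2t)\le \mathfrak{c}\,G(t)$ for all $t\ge0$, for some constant $\mathfrak{c}>2$), and $\lim_{t\to0^+}G(t)/t=0$. A positive measurable function $F$ on $(0,\infty)$ is regularly varying at $0$ with index $q$, written $F\in\mathcal{RV}_q(0)$, if $\lim_{t\to0^+}F(\lambda t)/F(t)=\lambda^q$ for every $\lambda>0$; $q$ is the index of $F$. Hypothesis (H): $G\in\mathcal{RV}_p(0)$ is a piecewise smooth Orlicz function, $G'\in\mathcal{RV}_{p-1}(0)$, and writing $G(t)=t^p\ell(t)$, one has $\ell(t)\ge c_\ell>0$ for all $t>0$. $L^G(\mathbb{R}^N)$ is the set of measurable $u$ with $\int_{\mathbb{R}^N}G(|u|)\,dx<\infty$. *)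

theory Defs
  imports "HOL-Analysis.Analysis"
begin

definition orlicz :: "(real \<Rightarrow> real) \<Rightarrow> bool" where
  "orlicz G \<longleftrightarrow>
     continuous_on {0..} G \<and> convex_on {0..} G \<and> mono_on {0..} G \<and>
     (\<forall>t\<ge>0. G t \<ge> 0) \<and> G 0 = 0 \<and>
     (\<exists>c>2. \<forall>t\<ge>0. G (2 * t) \<le> c * G t) \<and>
     ((\<lambda>t. G t / t) \<longlongrightarrow> 0) (at_right 0)"

definition regvar0 :: "(real \<Rightarrow> real) \<Rightarrow> real \<Rightarrow> bool" where
  "regvar0 F q \<longleftrightarrow>
     (\<forall>t>0. F t > 0) \<and> set_borel_measurable borel {0<..} F \<and>
     (\<forall>c>0. ((\<lambda>t. F (c * t) / F t) \<longlongrightarrow> c powr q) (at_right 0))"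

definition hypH :: "(real \<Rightarrow> real) \<Rightarrow> real \<Rightarrow> bool" where
  "hypH G p \<longleftrightarrow>
     orlicz G \<and> regvar0 G p \<and>
     G piecewise_C1_differentiable_on {0<..} \<and>
     (\<exists>g S. finite S \<and> (\<forall>t\<in>{0<..} - S. (G has_real_derivative g t) (at t)) \<and>
            regvar0 g (p - 1)) \<and>
     (\<exists>c>0. \<forall>t>0. G t / t powr p \<ge> c)"

definition LG :: "(real \<Rightarrow> real) \<Rightarrow> ('a::euclidean_space \<Rightarrow> real) \<Rightarrow> bool" where
  "LG G u \<longleftrightarrow> u \<in> borel_measurable lebesgue \<and>
     (\<integral>\<^sup>+x. ennreal (G \<bar>u x\<bar>) \<partial>lebesgue) < \<infinity>"

definition Lp :: "real \<Rightarrow> ('a::euclidean_space \<Rightarrow> real) \<Rightarrow> bool" where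
  "Lp p f \<longleftrightarrow> f \<in> borel_measurable lebesgue \<and> integrable lebesgue (\<lambda>x. \<bar>f x\<bar> powr p)"

fun Ck :: "nat \<Rightarrow> ('a::euclidean_space \<Rightarrow> real) \<Rightarrow> bool" where
  "Ck 0 f = continuous_on UNIV f"
| "Ck (Suc k) f = (\<exists>f'. (\<forall>x. (f has_derivative f' x) (at x)) \<and>
                        (\<forall>v. Ck k (\<lambda>x. f' x v)) \<and> continuous_on UNIV f)"

definition test_fun :: "('a::euclidean_space \<Rightarrow> real) \<Rightarrow> bool" where
  "test_fun \<phi> \<longleftrightarrow> (\<forall>k. Ck k \<phi>) \<and> compact (closure {x. \<phi> x \<noteq> 0})"

definition W1p :: "real \<Rightarrow> ('a::euclidean_space \<Rightarrow> real) \<Rightarrow> bool" where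
  "W1p p u \<longleftrightarrow> Lp p u \<and>
     (\<forall>i\<in>Basis. \<exists>g. Lp p g \<and>
        (\<forall>\<phi> \<phi>'. test_fun \<phi> \<and> (\<forall>x. (\<phi> has_derivative \<phi>' x) (at x)) \<longrightarrow>
           (\<integral>x. u x * \<phi>' x i \<partial>lebesgue) = - (\<integral>x. g x * \<phi> x \<partial>lebesgue)))"

end

theory Submission
  imports Defs "HOL-Probability.Probability_Measure"
begin

text \<open>Convolution with a mollifier \<open>\<rho>\<close> does not increase the nonlocal energy (Jensen and
  translation invariance), and \<open>\<rho> * u\<close> has directional derivatives \<open>D x z\<close> everywhere. Applied to
  \<open>\<rho> * u\<close>, Fatou's lemma along a sequence \<open>\<delta>\<^sub>n \<rightarrow> 0\<close> realising the liminf, together with regular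
  variation and monotonicity of \<open>G\<close>, bounds \<open>\<integral>\<integral>\<^bsub>|z|<1\<^esub> |D x z|\<^sup>p dz dx\<close> independently of \<open>\<rho>\<close>.
  So the partial derivatives of all mollifications of \<open>u\<close> lie in one ball of \<open>L\<^sup>p\<close>. Here \<open>p > 1\<close>,
  because \<open>G t / t \<longrightarrow> 0\<close> while \<open>G t \<ge> c t\<^sup>p\<close>. Weak compactness is replaced by a minimisation: the
  partial derivatives of mollifications at scale at most \<open>1/n\<close> form a convex set, and almost
  minimisers of a strictly convex functional on these decreasing sets converge almost everywhere.
  The limit is the weak derivative.\<close>

subsection \<open>Almost minimisers of a strictly convex functional\<close>

text \<open>The substitution h = \<delta> z explains the normalisation in the hypothesis. With T =
  \<delta>^(1-s), the argument of \<open>G\<close> becomes T times the difference quotient of step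
  \<delta>, divided by |z|^s, so dividing by G(T) compares \<open>G\<close> at two points that both
  tend to 0, where regular variation applies. The function \<open>u\<close> itself has no pointwise
  convergent difference quotients, which is why the estimate is made on mollifications. It bounds
  all directions z jointly; linearity in z recovers a single one. For the limit, midpoints of
  mollifiers are again mollifiers, which makes the candidate sets convex. The functional is the
  integral of sqrt(1 + t^2): its midpoint gap controls (a - b)^2 on bounded sets, and the p-th power
  bound takes care of large values. As sqrt(1 + t^2) \<ge> 1, it is integrated against a finite
  measure with the same null sets as Lebesgue measure. The analysis runs on a Borel representative
  of \<open>u\<close>, so that joint measurability and Tonelli's theorem are available.\<close>

lemma powr_add_le:
  fixes a b p :: real
  assumes "0 \<le> a" "0 \<le> b" "0 \<le> p"
  shows "(a + b) powr p \<le> 2 powr p * (a powr p + b powr p)"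
proof -
  have "(a + b) powr p \<le> (2 * max a b) powr p"
    using assms by (intro powr_mono2) auto
  also have "\<dots> = 2 powr p * max a b powr p"
    using assms by (intro powr_mult)
  also have "max a b powr p \<le> a powr p + b powr p"
    using assms by (auto simp: max_def)
  finally show ?thesis by simp
qed

lemma le_one_plus_powr:
  fixes a p :: real
  assumes "0 \<le> a" "1 \<le> p"
  shows "a \<le> 1 + a powr p"
proof (cases "a \<le> 1")
  case False
  then have "a powr 1 \<le> a powr p" using assms by (intro powr_mono) auto
  with False show ?thesis by simp
qed (simp add: add_increasing2)

text \<open>The roots are the Euclidean lengths of the plane vectors (1, a), (1, b) and of their
  midpoint. Factoring a difference of squares twice expresses (a - b)^2 as the gap times quantities
  bounded in terms of \<open>R\<close>. The constant is 2 (the gap is half of \<alpha> + \<beta> - 2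
  \<gamma>) times 2 (1 + R) times 2 (1 + R)^2.\<close>

lemma sqrt_convexity_gap:
  fixes a b R :: real
  assumes "\<bar>a\<bar> \<le> R" "\<bar>b\<bar> \<le> R"
  shows "(a - b)\<^sup>2 \<le> 8 * (1 + R) ^ 3 *
    ((sqrt (1 + a\<^sup>2) + sqrt (1 + b\<^sup>2)) / 2 - sqrt (1 + ((a + b) / 2)\<^sup>2))"
proof -
  define \<alpha> \<beta> \<gamma> where "\<alpha> = sqrt (1 + a\<^sup>2)" and "\<beta> = sqrt (1 + b\<^sup>2)"
    and "\<gamma> = sqrt (1 + ((a + b) / 2)\<^sup>2)"
  have R: "0 \<le> R" using assms by linarith
  have le: "sqrt (1 + x\<^sup>2) \<le> 1 + R" if "\<bar>x\<bar> \<le> R" for x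
  proof (rule real_le_lsqrt)
    have "x\<^sup>2 \<le> R\<^sup>2" using that R by (metis abs_le_square_iff abs_of_nonneg)
    then show "1 + x\<^sup>2 \<le> (1 + R)\<^sup>2" using R by (simp add: power2_eq_square algebra_simps)
  qed (use R in auto)
  have b: "\<alpha> \<le> 1 + R" "\<beta> \<le> 1 + R" "\<gamma> \<le> 1 + R"
    unfolding \<alpha>_def \<beta>_def \<gamma>_def using assms by (auto intro!: le)
  have pos: "0 \<le> \<alpha>" "0 \<le> \<beta>" "0 \<le> \<gamma>" by (auto simp: \<alpha>_def \<beta>_def \<gamma>_def)
  have sq: "\<alpha>\<^sup>2 = 1 + a\<^sup>2" "\<beta>\<^sup>2 = 1 + b\<^sup>2" "\<gamma>\<^sup>2 = 1 + ((a + b) / 2)\<^sup>2"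
    by (auto simp: \<alpha>_def \<beta>_def \<gamma>_def)
  \<comment> \<open>Lagrange's identity for (1, a) and (1, b): product of squared lengths = squared
    inner product + squared determinant.\<close>
  have e0: "(\<alpha> * \<beta>)\<^sup>2 = (1 + a * b)\<^sup>2 + (a - b)\<^sup>2"
    unfolding power_mult_distrib sq by (simp add: power2_eq_square algebra_simps)
  have e1: "(a - b)\<^sup>2 = (\<alpha> * \<beta> - (1 + a * b)) * (\<alpha> * \<beta> + (1 + a * b))"
    using e0 by (simp add: power2_eq_square algebra_simps)
  \<comment> \<open>The midpoint has length \<gamma>, so (\<alpha> + \<beta>)^2 - (2 \<gamma>)^2 is
    twice the defect in the Cauchy-Schwarz inequality.\<close>
  have e2: "\<alpha> * \<beta> - (1 + a * b) = (\<alpha> + \<beta> - 2 * \<gamma>) * ((\<alpha> + \<beta> + 2 * \<gamma>) / 2)"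
  proof -
    have "(\<alpha> + \<beta> - 2 * \<gamma>) * ((\<alpha> + \<beta> + 2 * \<gamma>) / 2) = (\<alpha>\<^sup>2 + \<beta>\<^sup>2 + 2 * (\<alpha> * \<beta>) - 4 * \<gamma>\<^sup>2) / 2"
      by (simp add: power2_eq_square algebra_simps)
    also have "\<dots> = \<alpha> * \<beta> - (1 + a * b)"
      unfolding sq by (simp add: power2_eq_square field_simps)
    finally show ?thesis by simp
  qed
  have "\<bar>1 + a * b\<bar> \<le> \<alpha> * \<beta>"
    using e0 pos by (metis abs_le_square_iff abs_of_nonneg mult_nonneg_nonneg zero_le_power2 le_add_same_cancel1)
  then have n1: "0 \<le> \<alpha> * \<beta> - (1 + a * b)" "0 \<le> \<alpha> * \<beta> + (1 + a * b)" by linarith+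
  have ge: "0 \<le> \<alpha> + \<beta> - 2 * \<gamma>"
  proof (rule ccontr)
    assume "\<not> ?thesis"
    moreover have "0 < (\<alpha> + \<beta> + 2 * \<gamma>) / 2"
      using pos sq(3) by (smt (verit) \<gamma>_def calculation half_gt_zero)
    ultimately have "(\<alpha> + \<beta> - 2 * \<gamma>) * ((\<alpha> + \<beta> + 2 * \<gamma>) / 2) < 0"
      by (intro mult_neg_pos) auto
    with e2 n1 show False by linarith
  qed
  have ab: "\<alpha> * \<beta> \<le> (1 + R)\<^sup>2"
    unfolding power2_eq_square using b pos R by (intro mult_mono) auto
  have "(a - b)\<^sup>2 = (\<alpha> + \<beta> - 2 * \<gamma>) * ((\<alpha> + \<beta> + 2 * \<gamma>) / 2) * (\<alpha> * \<beta> + (1 + a * b))"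
    using e1 e2 by simp
  also have "\<dots> \<le> (\<alpha> + \<beta> - 2 * \<gamma>) * (2 * (1 + R)) * (2 * (1 + R)\<^sup>2)"
    using b pos R ge n1 ab by (intro mult_mono mult_nonneg_nonneg) auto
  also have "\<dots> = 8 * (1 + R) ^ 3 * ((\<alpha> + \<beta>) / 2 - \<gamma>)"
    by (simp add: power2_eq_square power3_eq_cube field_simps)
  finally show ?thesis unfolding \<alpha>_def \<beta>_def \<gamma>_def .
qed

text \<open>A square is at most a positive multiple of the gap, by the previous estimate with R =
  |a| + |b|.\<close>

lemma sqrt_midpoint_convex:
  fixes a b :: real
  shows "0 \<le> (sqrt (1 + a\<^sup>2) + sqrt (1 + b\<^sup>2)) / 2 - sqrt (1 + ((a + b) / 2)\<^sup>2)"
proof -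
  let ?R = "\<bar>a\<bar> + \<bar>b\<bar>"
  have "0 \<le> 8 * (1 + ?R) ^ 3 *
    ((sqrt (1 + a\<^sup>2) + sqrt (1 + b\<^sup>2)) / 2 - sqrt (1 + ((a + b) / 2)\<^sup>2))"
    using sqrt_convexity_gap[of a ?R b] by (intro order_trans[OF zero_le_power2]) auto
  moreover have "0 < 8 * (1 + ?R) ^ 3" by (intro mult_pos_pos zero_less_power) auto
  ultimately show ?thesis by (meson less_le_not_le zero_le_mult_iff)
qed

text \<open>Turns a small convexity gap into a small \<open>L^1\<close> distance without any bound
  on \<open>a\<close> and \<open>b\<close>. Bounded values are handled by the quadratic estimate,
  large ones by their p-th powers, which beat |a| + |b| because p > 1.\<close>

lemma dist_le_convexity_gap:
  fixes p \<eta> :: real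
  assumes "1 < p" "0 < \<eta>"
  shows "\<exists>K\<ge>0. \<forall>a b :: real. \<bar>a - b\<bar> \<le> \<eta> * (1 + \<bar>a\<bar> powr p + \<bar>b\<bar> powr p) +
    K * ((sqrt (1 + a\<^sup>2) + sqrt (1 + b\<^sup>2)) / 2 - sqrt (1 + ((a + b) / 2)\<^sup>2))"
proof -
  \<comment> \<open>Solves 2^p R^(1-p) = \<eta>, the factor that appears in front of the p-th powers
    when |a| + |b| > R.\<close>
  define R where "R = (2 powr p / \<eta>) powr (1 / (p - 1))"
  have R0: "0 < R" using assms by (simp add: R_def)
  have "R powr (p - 1) = 2 powr p / \<eta>"
    using assms by (simp add: R_def powr_powr)
  then have R: "2 powr p * R powr (1 - p) = \<eta>"
    using assms R0 by (simp add: powr_minus_divide[of R "p - 1", simplified])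
  define K where "K = 8 * (1 + R) ^ 3 / (4 * \<eta>)"
  have K: "0 \<le> K" using R0 assms by (simp add: K_def)
  show ?thesis
  proof (intro exI[of _ K] conjI allI K)
    fix a b :: real
    let ?g = "(sqrt (1 + a\<^sup>2) + sqrt (1 + b\<^sup>2)) / 2 - sqrt (1 + ((a + b) / 2)\<^sup>2)"
    show "\<bar>a - b\<bar> \<le> \<eta> * (1 + \<bar>a\<bar> powr p + \<bar>b\<bar> powr p) + K * ?g"
    proof (cases "\<bar>a\<bar> + \<bar>b\<bar> \<le> R")
      case True
      \<comment> \<open>Young's inequality |a - b| \<le> \<eta> + (a - b)^2 / (4 \<eta>); this is
        where the denominator of \<open>K\<close> comes from.\<close>
      have "0 \<le> (\<bar>a - b\<bar> - 2 * \<eta>)\<^sup>2" by simp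
      then have "4 * \<eta> * \<bar>a - b\<bar> \<le> 4 * \<eta> * \<eta> + (a - b)\<^sup>2"
        by (simp add: power2_diff power_mult_distrib algebra_simps power2_eq_square)
      also have "(a - b)\<^sup>2 \<le> 8 * (1 + R) ^ 3 * ?g"
        using True by (intro sqrt_convexity_gap) auto
      also have "8 * (1 + R) ^ 3 * ?g = 4 * \<eta> * (K * ?g)"
        using assms by (simp add: K_def)
      finally have "4 * \<eta> * \<bar>a - b\<bar> \<le> 4 * \<eta> * (\<eta> + K * ?g)" by (simp add: algebra_simps)
      then have "\<bar>a - b\<bar> \<le> \<eta> + K * ?g" using assms by simp
      moreover have "\<eta> \<le> \<eta> * (1 + \<bar>a\<bar> powr p + \<bar>b\<bar> powr p)" using assms by simp
      ultimately show ?thesis by linarith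
    next
      case False
      let ?s = "\<bar>a\<bar> + \<bar>b\<bar>"
      have s: "0 < ?s" using False R0 by linarith
      have "\<bar>a - b\<bar> \<le> ?s" by linarith
      also have "?s = ?s powr p * ?s powr (1 - p)" using s by (simp flip: powr_add)
      also have "\<dots> \<le> (2 powr p * (\<bar>a\<bar> powr p + \<bar>b\<bar> powr p)) * R powr (1 - p)"
        using assms False R0 by (intro mult_mono powr_add_le powr_mono2') auto
      also have "\<dots> = \<eta> * (\<bar>a\<bar> powr p + \<bar>b\<bar> powr p)" using R by (simp add: algebra_simps)
      also have "\<dots> \<le> \<eta> * (1 + \<bar>a\<bar> powr p + \<bar>b\<bar> powr p)" using assms by simp
      also have "\<dots> \<le> \<dots> + K * ?g" using K sqrt_midpoint_convex[of a b] by simp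
      finally show ?thesis .
    qed
  qed
qed

text \<open>If two almost minimisers were far apart, their midpoint, which lies in the same convex
  set, would have an integral below the infimum. The infima over the decreasing sets increase to a
  finite limit, so the almost minimisers are Cauchy in \<open>L^1\<close>, and a subsequence
  converges almost everywhere.\<close>

lemma (in finite_measure) minimizing_sequence_AE_convergent:
  fixes K :: "nat \<Rightarrow> ('a \<Rightarrow> real) set" and p C :: real
  assumes p: "1 < p"
    and K: "decseq K" "\<And>n. K n \<noteq> {}"
    and mid: "\<And>n f g. f \<in> K n \<Longrightarrow> g \<in> K n \<Longrightarrow> (\<lambda>x. (f x + g x) / 2) \<in> K n"
    and meas: "\<And>n f. f \<in> K n \<Longrightarrow> f \<in> borel_measurable M"
    and int: "\<And>n f. f \<in> K n \<Longrightarrow> integrable M (\<lambda>x. \<bar>f x\<bar> powr p)"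
    and bnd: "\<And>n f. f \<in> K n \<Longrightarrow> (\<integral>x. \<bar>f x\<bar> powr p \<partial>M) \<le> C"
  obtains v g where "\<And>n. v n \<in> K n" "g \<in> borel_measurable M"
    "AE x in M. (\<lambda>n. v n x) \<longlonglongrightarrow> g x"
proof -
  define \<psi> where "\<psi> = (\<lambda>t::real. sqrt (1 + t\<^sup>2))"
  define \<Psi> where "\<Psi> = (\<lambda>f. \<integral>x. \<psi> (f x) \<partial>M)"
  define W where "W = measure M (space M)"
  have [measurable]: "\<psi> \<in> borel_measurable borel" by (simp add: \<psi>_def)
  have \<psi>0: "0 \<le> \<psi> t" for t by (simp add: \<psi>_def)
  have \<psi>_le: "\<psi> t \<le> 2 + \<bar>t\<bar> powr p" for t
  proof -
    have "\<psi> t \<le> 1 + \<bar>t\<bar>"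
      unfolding \<psi>_def by (rule real_le_lsqrt) (auto simp: power2_eq_square algebra_simps)
    also have "\<bar>t\<bar> \<le> 1 + \<bar>t\<bar> powr p" using p by (intro le_one_plus_powr) auto
    finally show ?thesis by simp
  qed
  have int\<psi>: "integrable M (\<lambda>x. \<psi> (f x))" if "f \<in> K n" for f n
  proof (rule Bochner_Integration.integrable_bound[where f="\<lambda>x. 2 + \<bar>f x\<bar> powr p"])
    show "integrable M (\<lambda>x. 2 + \<bar>f x\<bar> powr p)" using int[OF that] by simp
    show "(\<lambda>x. \<psi> (f x)) \<in> borel_measurable M" using meas[OF that] by simp
    show "AE x in M. norm (\<psi> (f x)) \<le> norm (2 + \<bar>f x\<bar> powr p)"
      using \<psi>_le \<psi>0 by (auto simp: abs_of_nonneg)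
  qed
  have int1: "integrable M f" if "f \<in> K n" for f n
  proof (rule Bochner_Integration.integrable_bound[where f="\<lambda>x. 1 + \<bar>f x\<bar> powr p"])
    show "integrable M (\<lambda>x. 1 + \<bar>f x\<bar> powr p)" using int[OF that] by simp
    show "f \<in> borel_measurable M" using meas[OF that] by simp
    show "AE x in M. norm (f x) \<le> norm (1 + \<bar>f x\<bar> powr p)"
      using le_one_plus_powr[of "\<bar>f x\<bar>" p for x] p by (auto simp: abs_of_nonneg)
  qed
  have \<Psi>0: "0 \<le> \<Psi> f" for f unfolding \<Psi>_def using \<psi>0 by simp
  have \<Psi>_le: "\<Psi> f \<le> 2 * W + C" if "f \<in> K n" for f n
  proof -
    have "\<Psi> f \<le> (\<integral>x. 2 + \<bar>f x\<bar> powr p \<partial>M)"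
      unfolding \<Psi>_def using int\<psi>[OF that] int[OF that] \<psi>_le by (intro integral_mono) auto
    also have "\<dots> = 2 * W + (\<integral>x. \<bar>f x\<bar> powr p \<partial>M)" using int[OF that] by (simp add: W_def)
    finally show ?thesis using bnd[OF that] by simp
  qed
  define d where "d n = Inf (\<Psi> ` K n)" for n
  have bdd: "bdd_below (\<Psi> ` K n)" for n using \<Psi>0 by (auto intro!: bdd_belowI[of _ 0])
  have d_le: "d n \<le> \<Psi> f" if "f \<in> K n" for f n
    unfolding d_def using that bdd by (auto intro!: cInf_lower)
  have Ksub: "K m \<subseteq> K n" if "n \<le> m" for n m using K(1) that by (auto dest: decseqD)
  have "incseq d"
    unfolding d_def incseq_def using K(2) bdd Ksub by (intro allI impI cInf_superset_mono image_mono) auto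
  moreover have "d n \<le> 2 * W + C" for n
    using K(2)[of n] d_le \<Psi>_le by (meson all_not_in_conv order_trans)
  ultimately obtain D where D: "d \<longlonglongrightarrow> D" "\<And>n. d n \<le> D"
    by (metis incseq_convergent)
  have "\<exists>f\<in>K n. \<Psi> f < d n + 1 / (Suc n)" for n
    using cInf_lessD[of "\<Psi> ` K n" "d n + 1 / Suc n"] K(2)[of n] by (auto simp: d_def)
  then obtain v where v: "\<And>n. v n \<in> K n" "\<And>n. \<Psi> (v n) < d n + 1 / (Suc n)" by metis
  \<comment> \<open>Adds two errors: the tolerance \<open>1 / Suc n\<close> in the choice of
    \<open>v n\<close>, and the distance of \<open>d n\<close> from the limit \<open>D\<close>. The
    second is needed because \<open>v m\<close> is almost minimal for the smaller set
    \<open>K m\<close> but is compared with the infimum over \<open>K n\<close>.\<close>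
  define e where "e n = D - d n + 1 / Suc n" for n
  have e: "e \<longlonglongrightarrow> 0"
    unfolding e_def using tendsto_add[OF tendsto_diff[OF tendsto_const[of D] D(1)] LIMSEQ_Suc[OF lim_1_over_n]]
    by simp
  have gap: "(\<integral>x. (\<psi> (v n x) + \<psi> (v m x)) / 2 - \<psi> ((v n x + v m x) / 2) \<partial>M) \<le> e n + e m"
    if "n \<le> m" for n m
  proof -
    have inn: "v m \<in> K n" using v(1) Ksub[OF that] by auto
    have "d n \<le> \<Psi> (\<lambda>x. (v n x + v m x) / 2)" by (intro d_le mid v inn)
    moreover have "(\<integral>x. (\<psi> (v n x) + \<psi> (v m x)) / 2 - \<psi> ((v n x + v m x) / 2) \<partial>M)
      = (\<Psi> (v n) + \<Psi> (v m)) / 2 - \<Psi> (\<lambda>x. (v n x + v m x) / 2)"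
      unfolding \<Psi>_def using int\<psi>[OF v(1)[of n]] int\<psi>[OF inn] int\<psi>[OF mid[OF v(1)[of n] inn]]
      by simp
    moreover define q where "q k = 1 / real (Suc k)" for k
    have "0 \<le> q n" "0 \<le> q m" by (simp_all add: q_def)
    ultimately show ?thesis
      using v(2)[of n] v(2)[of m] D(2)[of n] D(2)[of m] unfolding e_def q_def[symmetric] by argo
  qed
  have C0: "0 \<le> C"
  proof -
    have "0 \<le> (\<integral>x. \<bar>v 0 x\<bar> powr p \<partial>M)" by simp
    also have "\<dots> \<le> C" by (rule bnd[OF v(1)])
    finally show ?thesis .
  qed
  have W0: "0 \<le> W" by (simp add: W_def)
  have cauchy: "\<exists>N. \<forall>i\<ge>N. \<forall>j\<ge>N. (\<integral>x. norm (v i x - v j x) \<partial>M) < r" if r: "0 < r" for r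
  proof -
    \<comment> \<open>Chosen so that the total mass \<open>W\<close> and the two p-th power
      integrals, each at most \<open>C\<close>, contribute at most r / 2. The summand 1 keeps the
      denominator positive.\<close>
    define \<eta> where "\<eta> = r / (2 * (W + 2 * C + 1))"
    have \<eta>: "0 < \<eta>" using r W0 C0 by (simp add: \<eta>_def)
    have \<eta>r: "\<eta> * (W + 2 * C) \<le> r / 2"
    proof -
      have "\<eta> * (W + 2 * C) \<le> \<eta> * (W + 2 * C + 1)" using \<eta> by simp
      also have "\<dots> = r / 2"
      proof -
        have "W + 2 * C + 1 \<noteq> 0" using W0 C0 by linarith
        then show ?thesis by (simp add: \<eta>_def field_simps)
      qed
      finally show ?thesis .
    qed
    obtain k where k: "0 \<le> k" "\<And>a b. \<bar>a - b\<bar> \<le> \<eta> * (1 + \<bar>a\<bar> powr p + \<bar>b\<bar> powr p) +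
      k * ((\<psi> a + \<psi> b) / 2 - \<psi> ((a + b) / 2))"
      using dist_le_convexity_gap[OF p \<eta>] unfolding \<psi>_def by blast
    have key: "(\<integral>x. \<bar>v i x - v j x\<bar> \<partial>M) \<le> r / 2 + k * (e i + e j)" if ij: "i \<le> j" for i j
    proof -
      have inn: "v j \<in> K i" using v(1) Ksub[OF ij] by auto
      note I = int\<psi>[OF v(1)[of i]] int\<psi>[OF inn] int\<psi>[OF mid[OF v(1)[of i] inn]]
        int[OF v(1)[of i]] int[OF inn] int1[OF v(1)[of i]] int1[OF inn]
      have "(\<integral>x. \<bar>v i x - v j x\<bar> \<partial>M) \<le> (\<integral>x. \<eta> * (1 + \<bar>v i x\<bar> powr p + \<bar>v j x\<bar> powr p) +
          k * ((\<psi> (v i x) + \<psi> (v j x)) / 2 - \<psi> ((v i x + v j x) / 2)) \<partial>M)"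
        using I k(2) by (intro integral_mono) auto
      also have "\<dots> = \<eta> * (W + (\<integral>x. \<bar>v i x\<bar> powr p \<partial>M) + (\<integral>x. \<bar>v j x\<bar> powr p \<partial>M))
          + k * (\<integral>x. (\<psi> (v i x) + \<psi> (v j x)) / 2 - \<psi> ((v i x + v j x) / 2) \<partial>M)"
        using I by (simp add: W_def)
      also have "\<dots> \<le> \<eta> * (W + C + C) + k * (e i + e j)"
        using bnd[OF v(1)[of i]] bnd[OF inn] gap[OF ij] k(1) \<eta>
        by (intro add_mono mult_left_mono) auto
      finally show ?thesis using \<eta>r by (simp add: algebra_simps)
    qed
    have "(\<lambda>n. k * e n) \<longlonglongrightarrow> 0" using tendsto_mult[OF tendsto_const[of k] e] by simp
    then have "\<forall>\<^sub>F n in sequentially. k * e n < r / 4" using r by (intro order_tendstoD) auto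
    then obtain N where N: "\<And>n. N \<le> n \<Longrightarrow> k * e n < r / 4" by (auto simp: eventually_sequentially)
    have "(\<integral>x. \<bar>v i x - v j x\<bar> \<partial>M) < r" if "N \<le> i" "N \<le> j" for i j
    proof (cases "i \<le> j")
      case True
      then show ?thesis using key[OF True] N[OF that(1)] N[OF that(2)] by (simp add: algebra_simps)
    next
      case False
      then show ?thesis using key[of j i] N[OF that(1)] N[OF that(2)]
        by (simp add: algebra_simps abs_minus_commute)
    qed
    then show ?thesis by (intro exI[of _ N]) auto
  qed
  obtain r where r: "strict_mono r" and ae: "AE x in M. Cauchy (\<lambda>i. v (r i) x)"
    using cauchy_L1_AE_cauchy_subseq[of M v, OF int1[OF v(1)]] cauchy by blast
  \<comment> \<open>Passing to the subsequence keeps the membership in \<open>K n\<close>, because r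
    n \<ge> n and the sets decrease.\<close>
  show thesis
  proof (rule that[of "\<lambda>n. v (r n)" "\<lambda>x. lim (\<lambda>n. v (r n) x)"])
    show "v (r n) \<in> K n" for n
      using v(1) Ksub[OF seq_suble[OF r]] by auto
    show "(\<lambda>x. lim (\<lambda>n. v (r n) x)) \<in> borel_measurable M"
      using meas[OF v(1)] by (intro borel_measurable_lim_metric) auto
    show "AE x in M. (\<lambda>n. v (r n) x) \<longlonglongrightarrow> lim (\<lambda>n. v (r n) x)"
      using ae by eventually_elim (auto simp: Cauchy_convergent_iff convergent_LIMSEQ_iff)
  qed
qed

section \<open>Almost everywhere limits under an \<open>L^p\<close> bound\<close>

text \<open>Fatou's lemma, where the lower limit is a true limit almost everywhere.\<close>

lemma Lp_bounded_AE_limit: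
  fixes v :: "nat \<Rightarrow> 'a \<Rightarrow> real" and p C :: real
  assumes p: "1 < p"
    and [measurable]: "\<And>n. v n \<in> borel_measurable M" "g \<in> borel_measurable M"
    and bnd: "\<And>n. (\<integral>\<^sup>+x. ennreal (\<bar>v n x\<bar> powr p) \<partial>M) \<le> ennreal C"
    and lim: "AE x in M. (\<lambda>n. v n x) \<longlonglongrightarrow> g x"
  shows "(\<integral>\<^sup>+x. ennreal (\<bar>g x\<bar> powr p) \<partial>M) \<le> ennreal C"
proof -
  have "(\<integral>\<^sup>+x. ennreal (\<bar>g x\<bar> powr p) \<partial>M) = (\<integral>\<^sup>+x. liminf (\<lambda>n. ennreal (\<bar>v n x\<bar> powr p)) \<partial>M)"
  proof (intro nn_integral_cong_AE)
    show "AE x in M. ennreal (\<bar>g x\<bar> powr p) = liminf (\<lambda>n. ennreal (\<bar>v n x\<bar> powr p))"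
      using lim
    proof eventually_elim
      case (elim x)
      have "(\<lambda>n. ennreal (\<bar>v n x\<bar> powr p)) \<longlonglongrightarrow> ennreal (\<bar>g x\<bar> powr p)"
        using p by (intro tendsto_ennrealI tendsto_powr' tendsto_rabs elim tendsto_const) auto
      then show ?case by (intro lim_imp_Liminf[symmetric]) auto
    qed
  qed
  also have "\<dots> \<le> liminf (\<lambda>n. \<integral>\<^sup>+x. ennreal (\<bar>v n x\<bar> powr p) \<partial>M)"
    by (intro nn_integral_liminf) simp
  also have "\<dots> \<le> liminf (\<lambda>n. ennreal C)"
    by (intro Liminf_mono always_eventually allI bnd)
  also have "\<dots> = ennreal C" by (simp add: Liminf_const)
  finally show ?thesis .
qed


lemma integrable_powr_of_nn_integral_le:
  fixes f :: "'a \<Rightarrow> real"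
  assumes [measurable]: "f \<in> borel_measurable M"
    and bnd: "(\<integral>\<^sup>+x. ennreal (\<bar>f x\<bar> powr p) \<partial>M) \<le> ennreal C"
  shows "integrable M (\<lambda>x. \<bar>f x\<bar> powr p)"
proof (rule integrableI_bounded)
  have "(\<integral>\<^sup>+x. ennreal (norm (\<bar>f x\<bar> powr p)) \<partial>M) \<le> ennreal C" using bnd by simp
  then show "(\<integral>\<^sup>+x. ennreal (norm (\<bar>f x\<bar> powr p)) \<partial>M) < \<infinity>"
    by (simp add: order_le_less_trans less_top)
qed simp

text \<open>Boundedness in \<open>L\<^sup>p\<close> with \<open>p > 1\<close> is uniform integrability: a truncation at height \<open>R\<close>
  costs at most \<open>O(R\<^bsup>1-p\<^esup>)\<close> in \<open>L\<^sup>1\<close>.\<close>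

lemma Lp_bounded_AE_limit_weak:
  fixes v :: "nat \<Rightarrow> 'a \<Rightarrow> real" and p C B :: real
  assumes p: "1 < p" and C: "0 \<le> C"
    and [measurable]: "\<And>n. v n \<in> borel_measurable M" "g \<in> borel_measurable M"
      "\<phi> \<in> borel_measurable M" "A \<in> sets M"
    and bnd: "\<And>n. (\<integral>\<^sup>+x. ennreal (\<bar>v n x\<bar> powr p) \<partial>M) \<le> ennreal C"
    and lim: "AE x in M. (\<lambda>n. v n x) \<longlonglongrightarrow> g x"
    and A: "emeasure M A < \<infinity>" and \<phi>: "\<And>x. \<bar>\<phi> x\<bar> \<le> B * indicator A x"
  shows "(\<lambda>n. \<integral>x. v n x * \<phi> x \<partial>M) \<longlonglongrightarrow> (\<integral>x. g x * \<phi> x \<partial>M)"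
proof -
  have g: "(\<integral>\<^sup>+x. ennreal (\<bar>g x\<bar> powr p) \<partial>M) \<le> ennreal C"
    by (rule Lp_bounded_AE_limit[OF p _ _ bnd lim]) measurable
  have iA: "integrable M (indicator A :: 'a \<Rightarrow> real)"
    using A by (simp add: integrable_indicator_iff)
  have prod_int: "integrable M (\<lambda>x. f x * \<phi> x)"
    if [measurable]: "f \<in> borel_measurable M" and "(\<integral>\<^sup>+x. ennreal (\<bar>f x\<bar> powr p) \<partial>M) \<le> ennreal C" for f
  proof (rule Bochner_Integration.integrable_bound[where f="\<lambda>x. B * (indicator A x + \<bar>f x\<bar> powr p)"])
    show "integrable M (\<lambda>x. B * (indicator A x + \<bar>f x\<bar> powr p))"
      using iA integrable_powr_of_nn_integral_le[OF that] by simp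
    have "\<bar>f x * \<phi> x\<bar> \<le> \<bar>B * (indicator A x + \<bar>f x\<bar> powr p)\<bar>" for x
    proof -
      have "\<bar>f x * \<phi> x\<bar> \<le> (1 + \<bar>f x\<bar> powr p) * (B * indicator A x)"
        unfolding abs_mult using \<phi>[of x] le_one_plus_powr[of "\<bar>f x\<bar>" p] p by (intro mult_mono) auto
      also have "\<dots> \<le> \<bar>B\<bar> * (indicator A x + \<bar>f x\<bar> powr p)"
        by (auto simp: indicator_def algebra_simps intro!: add_mono mult_right_mono)
      finally show ?thesis by (simp add: abs_mult)
    qed
    then show "AE x in M. norm (f x * \<phi> x) \<le> norm (B * (indicator A x + \<bar>f x\<bar> powr p))" by simp
  qed simp
  define D where "D n x = \<bar>v n x - g x\<bar>" for n x
  have [measurable]: "D n \<in> borel_measurable M" for n unfolding D_def by measurable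
  define C' where "C' = 2 powr p * (C + C)"
  have C': "0 \<le> C'" using C by (simp add: C'_def)
  have Dp: "(\<integral>\<^sup>+x. ennreal (\<bar>D n x\<bar> powr p) \<partial>M) \<le> ennreal C'" for n
  proof -
    have "(\<integral>\<^sup>+x. ennreal (\<bar>D n x\<bar> powr p) \<partial>M)
      \<le> (\<integral>\<^sup>+x. ennreal (2 powr p) * (ennreal (\<bar>v n x\<bar> powr p) + ennreal (\<bar>g x\<bar> powr p)) \<partial>M)"
    proof (intro nn_integral_mono)
      fix x
      have "\<bar>D n x\<bar> powr p \<le> (\<bar>v n x\<bar> + \<bar>g x\<bar>) powr p" using p by (intro powr_mono2) (auto simp: D_def)
      also have "\<dots> \<le> 2 powr p * (\<bar>v n x\<bar> powr p + \<bar>g x\<bar> powr p)" using p by (intro powr_add_le) auto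
      finally show "ennreal (\<bar>D n x\<bar> powr p)
        \<le> ennreal (2 powr p) * (ennreal (\<bar>v n x\<bar> powr p) + ennreal (\<bar>g x\<bar> powr p))"
        by (simp flip: ennreal_plus ennreal_mult add: ennreal_leI)
    qed
    also have "\<dots> = ennreal (2 powr p) * ((\<integral>\<^sup>+x. ennreal (\<bar>v n x\<bar> powr p) \<partial>M) + (\<integral>\<^sup>+x. ennreal (\<bar>g x\<bar> powr p) \<partial>M))"
      by (simp add: nn_integral_cmult nn_integral_add)
    also have "\<dots> \<le> ennreal (2 powr p) * (ennreal C + ennreal C)"
      by (intro mult_left_mono add_mono bnd g) auto
    also have "\<dots> = ennreal C'" using C by (simp flip: ennreal_plus ennreal_mult add: C'_def)
    finally show ?thesis .
  qed
  have Dpi: "integrable M (\<lambda>x. \<bar>D n x\<bar> powr p)" for n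
    by (rule integrable_powr_of_nn_integral_le[OF _ Dp]) simp
  have DpC: "(\<integral>x. \<bar>D n x\<bar> powr p \<partial>M) \<le> C'" for n
    using integral_real_bounded[OF C' Dp] .
  have mini: "integrable M (\<lambda>x. min (D n x) R * indicator A x)" if "0 < R" for n R
  proof (rule Bochner_Integration.integrable_bound[where f="\<lambda>x. R * indicator A x"])
    show "integrable M (\<lambda>x. R * indicator A x :: real)" using iA by simp
  qed (use that in \<open>auto simp: D_def indicator_def\<close>)
  have minlim: "(\<lambda>n. \<integral>x. min (D n x) R * indicator A x \<partial>M) \<longlonglongrightarrow> 0" if "0 < R" for R
  proof -
    have "(\<lambda>n. \<integral>x. min (D n x) R * indicator A x \<partial>M) \<longlonglongrightarrow> (\<integral>x. 0 \<partial>M)"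
    proof (rule integral_dominated_convergence[where w="\<lambda>x. R * indicator A x"])
      show "integrable M (\<lambda>x. R * indicator A x :: real)" using iA by simp
      show "AE x in M. (\<lambda>n. min (D n x) R * indicator A x) \<longlonglongrightarrow> 0"
        using lim
      proof eventually_elim
        case (elim x)
        have "(\<lambda>n. min (D n x) R * indicator A x) \<longlonglongrightarrow> min \<bar>g x - g x\<bar> R * indicator A x"
          unfolding D_def by (intro tendsto_intros elim)
        then show ?case using that by simp
      qed
    qed (use that in \<open>auto simp: D_def indicator_def\<close>)
    then show ?thesis by simp
  qed
  have key: "\<bar>(\<integral>x. v n x * \<phi> x \<partial>M) - (\<integral>x. g x * \<phi> x \<partial>M)\<bar>
      \<le> \<bar>B\<bar> * (\<integral>x. min (D n x) R * indicator A x \<partial>M) + \<bar>B\<bar> * (C' * R powr (1 - p))"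
    if R: "0 < R" for n R
  proof -
    have "\<bar>(\<integral>x. v n x * \<phi> x \<partial>M) - (\<integral>x. g x * \<phi> x \<partial>M)\<bar> = \<bar>\<integral>x. v n x * \<phi> x - g x * \<phi> x \<partial>M\<bar>"
      using prod_int[OF _ bnd] prod_int[OF _ g] by simp
    also have "\<dots> \<le> (\<integral>x. \<bar>v n x * \<phi> x - g x * \<phi> x\<bar> \<partial>M)" by (rule integral_abs_bound)
    also have "\<dots> \<le> (\<integral>x. \<bar>B\<bar> * (min (D n x) R * indicator A x + \<bar>D n x\<bar> powr p * R powr (1 - p)) \<partial>M)"
    proof (rule integral_mono)
      show "integrable M (\<lambda>x. \<bar>v n x * \<phi> x - g x * \<phi> x\<bar>)"
        using prod_int[OF _ bnd] prod_int[OF _ g] by simp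
      show "integrable M (\<lambda>x. \<bar>B\<bar> * (min (D n x) R * indicator A x + \<bar>D n x\<bar> powr p * R powr (1 - p)))"
        using mini[OF R] Dpi by simp
      fix x
      have "\<bar>v n x * \<phi> x - g x * \<phi> x\<bar> = D n x * \<bar>\<phi> x\<bar>"
        by (simp add: D_def flip: left_diff_distrib abs_mult)
      also have "\<dots> \<le> D n x * (\<bar>B\<bar> * indicator A x)"
        using \<phi>[of x] by (intro mult_left_mono) (auto simp: D_def indicator_def split: if_splits)
      also have "\<dots> = \<bar>B\<bar> * (D n x * indicator A x)" by simp
      also have "D n x * indicator A x \<le> min (D n x) R * indicator A x + \<bar>D n x\<bar> powr p * R powr (1 - p)"
      proof (cases "D n x \<le> R")
        case False
        have "D n x = D n x powr p * D n x powr (1 - p)" using False R by (simp flip: powr_add)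
        also have "\<dots> \<le> D n x powr p * R powr (1 - p)"
          using False R p by (intro mult_left_mono powr_mono2') auto
        finally show ?thesis using False R by (auto simp: indicator_def)
      qed simp
      finally show "\<bar>v n x * \<phi> x - g x * \<phi> x\<bar> \<le>
          \<bar>B\<bar> * (min (D n x) R * indicator A x + \<bar>D n x\<bar> powr p * R powr (1 - p))"
        by (simp add: mult_left_mono)
    qed
    also have "\<dots> = \<bar>B\<bar> * ((\<integral>x. min (D n x) R * indicator A x \<partial>M) + (\<integral>x. \<bar>D n x\<bar> powr p \<partial>M) * R powr (1 - p))"
      using mini[OF R] Dpi by simp
    also have "\<dots> \<le> \<bar>B\<bar> * ((\<integral>x. min (D n x) R * indicator A x \<partial>M) + C' * R powr (1 - p))"
      by (intro mult_left_mono add_mono order_refl mult_right_mono DpC) auto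
    finally show ?thesis by (simp add: algebra_simps)
  qed
  show ?thesis
  proof (rule LIMSEQ_I, unfold real_norm_def)
    fix r :: real assume r: "0 < r"
    \<comment> \<open>The truncation height is fixed first, since its error is uniform in
      \<open>n\<close>; only then does dominated convergence on \<open>A\<close> choose
      \<open>N\<close>.\<close>
    have "((\<lambda>R. \<bar>B\<bar> * (C' * R powr (1 - p))) \<longlongrightarrow> \<bar>B\<bar> * (C' * 0)) at_top"
      using p by (intro tendsto_intros tendsto_neg_powr filterlim_ident) auto
    then have "\<forall>\<^sub>F R in at_top. \<bar>B\<bar> * (C' * R powr (1 - p)) < r / 2"
      using r by (intro order_tendstoD) auto
    then have "\<forall>\<^sub>F R in at_top. \<bar>B\<bar> * (C' * R powr (1 - p)) < r / 2 \<and> (0::real) < R"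
      by (intro eventually_conj eventually_gt_at_top)
    then obtain R where R: "0 < R" "\<bar>B\<bar> * (C' * R powr (1 - p)) < r / 2"
      using eventually_happens by force
    have "(\<lambda>n. \<bar>B\<bar> * (\<integral>x. min (D n x) R * indicator A x \<partial>M)) \<longlonglongrightarrow> \<bar>B\<bar> * 0"
      by (intro tendsto_mult tendsto_const minlim R)
    then have "\<forall>\<^sub>F n in sequentially. \<bar>B\<bar> * (\<integral>x. min (D n x) R * indicator A x \<partial>M) < r / 2"
      using r by (intro order_tendstoD) auto
    then obtain N where N: "\<And>n. N \<le> n \<Longrightarrow> \<bar>B\<bar> * (\<integral>x. min (D n x) R * indicator A x \<partial>M) < r / 2"
      by (auto simp: eventually_sequentially)
    show "\<exists>N. \<forall>n\<ge>N. \<bar>(\<integral>x. v n x * \<phi> x \<partial>M) - (\<integral>x. g x * \<phi> x \<partial>M)\<bar> < r"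
    proof (intro exI[of _ N] allI impI)
      fix n assume "N \<le> n"
      with key[OF R(1), of n] R(2) N[of n] show "\<bar>(\<integral>x. v n x * \<phi> x \<partial>M) - (\<integral>x. g x * \<phi> x \<partial>M)\<bar> < r"
        by linarith
    qed
  qed
qed

subsection \<open>Translations and compactly supported functions of class \<open>C\<^sup>1\<close>\<close>

lemma ball_cball_borel [measurable]:
  fixes x :: "'a::metric_space"
  shows "ball x r \<in> sets borel" "cball x r \<in> sets borel"
  by auto

text \<open>The value c = 1 gives translations and c = -1 gives reflections, the two changes of
  variable that convolutions use.\<close>

lemma lborel_distr_isometry:
  fixes t :: "'a::euclidean_space"
  assumes "\<bar>c\<bar> = 1"
  shows "distr lborel borel (\<lambda>x. t + c *\<^sub>R x) = lborel"
  using lborel_affine[of c t] assms by (auto simp: density_1)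

lemma nn_integral_lborel_affine:
  fixes t :: "'a::euclidean_space"
  assumes [measurable]: "f \<in> borel_measurable borel" and c: "c \<noteq> 0"
  shows "(\<integral>\<^sup>+x. f x \<partial>lborel) = ennreal (\<bar>c\<bar> ^ DIM('a)) * (\<integral>\<^sup>+x. f (t + c *\<^sub>R x) \<partial>lborel)"
  by (subst lborel_affine[OF c, of t])
     (simp add: nn_integral_density nn_integral_distr nn_integral_cmult)

lemma nn_integral_lborel_shift:
  fixes t :: "'a::euclidean_space"
  assumes "f \<in> borel_measurable borel"
  shows "(\<integral>\<^sup>+x. f (t + x) \<partial>lborel) = (\<integral>\<^sup>+x. f x \<partial>lborel)"
  using nn_integral_lborel_affine[of f 1 t] assms by simp

lemma integral_lborel_isometry:
  fixes t :: "'a::euclidean_space" and f :: "'a \<Rightarrow> real"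
  assumes "f \<in> borel_measurable borel" "\<bar>c\<bar> = 1"
  shows "(\<integral>x. f (t + c *\<^sub>R x) \<partial>lborel) = (\<integral>x. f x \<partial>lborel)"
    and "integrable lborel (\<lambda>x. f (t + c *\<^sub>R x)) \<longleftrightarrow> integrable lborel f"
  using integral_distr[of "\<lambda>x. t + c *\<^sub>R x" lborel borel f]
    integrable_distr_eq[of "\<lambda>x. t + c *\<^sub>R x" lborel borel f] assms
  by (simp_all add: lborel_distr_isometry)

lemma integral_lborel_shift:
  fixes t :: "'a::euclidean_space" and f :: "'a \<Rightarrow> real"
  assumes "f \<in> borel_measurable borel"
  shows "(\<integral>x. f (x + t) \<partial>lborel) = (\<integral>x. f x \<partial>lborel)"
    and "integrable lborel (\<lambda>x. f (x + t)) \<longleftrightarrow> integrable lborel f"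
  using integral_lborel_isometry[of f 1 t] assms by (simp_all add: add.commute)

lemma integral_lborel_reflect:
  fixes t :: "'a::euclidean_space" and f :: "'a \<Rightarrow> real"
  assumes "f \<in> borel_measurable borel"
  shows "(\<integral>x. f (t - x) \<partial>lborel) = (\<integral>x. f x \<partial>lborel)"
    and "integrable lborel (\<lambda>x. f (t - x)) \<longleftrightarrow> integrable lborel f"
  using integral_lborel_isometry[of f "-1" t] assms by simp_all

lemma le_mult_indicatorD: "a \<le> B * indicator A x \<Longrightarrow> 0 \<le> B \<Longrightarrow> a \<le> (B::real)"
  by (cases "x \<in> A") auto

lemma integrable_bounded_mult:
  fixes f h :: "'a \<Rightarrow> real"
  assumes "integrable M h" "f \<in> borel_measurable M" "\<And>x. \<bar>f x\<bar> \<le> B"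
  shows "integrable M (\<lambda>x. f x * h x)"
proof (rule Bochner_Integration.integrable_bound[where f="\<lambda>x. B * h x"])
  show "AE x in M. norm (f x * h x) \<le> norm (B * h x)"
    using order_trans[OF assms(3) abs_ge_self]
    by (auto simp: abs_mult intro!: always_eventually mult_right_mono)
qed (use assms in auto)

section \<open>Bounds, difference quotients and integration by parts for compactly supported
  \<open>C^1\<close> functions\<close>

lemma continuous_compact_support_bound:
  fixes h :: "'a::euclidean_space \<Rightarrow> real"
  assumes "continuous_on UNIV h" "\<And>x. R < norm x \<Longrightarrow> h x = 0"
  obtains B where "0 \<le> B" "\<And>x. \<bar>h x\<bar> \<le> B * indicator (cball 0 R) x"
proof -
  have "compact (h ` cball 0 R)"
    using assms(1) by (intro compact_continuous_image) (auto intro: continuous_on_subset)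
  then have "bounded (h ` cball 0 R)" by (rule compact_imp_bounded)
  then obtain B where "\<forall>x\<in>cball 0 R. \<bar>h x\<bar> \<le> B"
    by (auto simp: bounded_iff)
  then have B: "\<bar>h x\<bar> \<le> B" if "norm x \<le> R" for x using that by simp
  show thesis
  proof (rule that[of "max 0 B"])
    show "\<bar>h x\<bar> \<le> max 0 B * indicator (cball 0 R) x" for x
      using B[of x] assms(2)[of x] by (auto simp: indicator_def not_le)
  qed auto
qed

text \<open>The derivative is carried as explicit data, because the derivative of a kernel is itself
  convolved with \<open>u\<close>. The predicate serves both mollifiers and test functions.\<close>

definition C1c :: "('a::euclidean_space \<Rightarrow> real) \<Rightarrow> ('a \<Rightarrow> 'a \<Rightarrow> real) \<Rightarrow> bool" where
  "C1c f f' \<longleftrightarrow> (\<forall>x. (f has_derivative f' x) (at x)) \<and> (\<forall>v. continuous_on UNIV (\<lambda>x. f' x v)) \<and>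
     (\<exists>R. \<forall>x. f x \<noteq> 0 \<longrightarrow> norm x \<le> R)"

lemma C1c_continuous: "C1c f f' \<Longrightarrow> continuous_on UNIV f"
  unfolding C1c_def by (meson has_derivative_continuous continuous_at_imp_continuous_on)

lemma C1c_borel [measurable_dest]:
  assumes "C1c f f'"
  shows "f \<in> borel_measurable borel" "(\<lambda>x. f' x v) \<in> borel_measurable borel"
  using C1c_continuous[OF assms] assms unfolding C1c_def
  by (auto intro: borel_measurable_continuous_onI)

lemma derivative_eq_0_outside_support:
  fixes f :: "'a::euclidean_space \<Rightarrow> real"
  assumes "(f has_derivative f') (at x)" "\<And>x. f x \<noteq> 0 \<Longrightarrow> norm x \<le> R" "R < norm x"
  shows "f' v = 0"
proof -
  have "(f has_derivative (\<lambda>_. 0)) (at x)"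
  proof (rule has_derivative_transform_within_open[OF has_derivative_const[of 0]])
    show "open (- cball 0 R :: 'a set)" by auto
    show "x \<in> - cball 0 R" using assms by auto
    show "\<And>y. y \<in> - cball 0 R \<Longrightarrow> 0 = f y" using assms(2) by (force simp: not_le)
  qed
  with assms(1) have "f' = (\<lambda>_. 0)" by (rule has_derivative_unique)
  then show ?thesis by simp
qed

lemma C1c_bounds:
  fixes f :: "'a::euclidean_space \<Rightarrow> real"
  assumes "C1c f f'" "\<And>x. f x \<noteq> 0 \<Longrightarrow> norm x \<le> R"
  obtains B where "0 \<le> B" "\<And>x. \<bar>f x\<bar> \<le> B * indicator (cball 0 R) x"
    "\<And>x. \<bar>f' x v\<bar> \<le> B * indicator (cball 0 R) x"
proof -
  have "f x = 0" if "R < norm x" for x using that assms(2)[of x] by linarith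
  then obtain B1 where B1: "0 \<le> B1" "\<And>x. \<bar>f x\<bar> \<le> B1 * indicator (cball 0 R) x"
    using continuous_compact_support_bound[OF C1c_continuous[OF assms(1)], of R] by metis
  have d: "(f has_derivative f' x) (at x)" for x using assms(1) by (simp add: C1c_def)
  have "continuous_on UNIV (\<lambda>x. f' x v)" using assms(1) by (simp add: C1c_def)
  moreover have "f' x v = 0" if "R < norm x" for x
    using derivative_eq_0_outside_support[OF d assms(2) that] .
  ultimately obtain B2 where B2: "0 \<le> B2" "\<And>x. \<bar>f' x v\<bar> \<le> B2 * indicator (cball 0 R) x"
    using continuous_compact_support_bound[of "\<lambda>x. f' x v" R] by metis
  show thesis
  proof (rule that[of "max B1 B2"])
    show "\<bar>f x\<bar> \<le> max B1 B2 * indicator (cball 0 R) x" for x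
      using B1(2)[of x] by (auto simp: indicator_def)
    show "\<bar>f' x v\<bar> \<le> max B1 B2 * indicator (cball 0 R) x" for x
      using B2(2)[of x] by (auto simp: indicator_def)
  qed (use B1 in auto)
qed

lemma integrable_indicator_cball: "integrable lborel (\<lambda>x::'a::euclidean_space. B * indicator (cball 0 R) x :: real)"
  by (intro integrable_mult_right integrable_real_indicator) (auto simp: emeasure_lborel_cball_finite[unfolded infinity_ennreal_def])

lemma C1c_integrable:
  fixes f :: "'a::euclidean_space \<Rightarrow> real"
  assumes "C1c f f'"
  shows "integrable lborel f" "integrable lborel (\<lambda>x. f' x v)"
proof -
  obtain R where R: "\<And>x. f x \<noteq> 0 \<Longrightarrow> norm x \<le> R" using assms by (auto simp: C1c_def)
  obtain B where B: "0 \<le> B" "\<And>x. \<bar>f x\<bar> \<le> B * indicator (cball 0 R) x"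
    "\<And>x. \<bar>f' x v\<bar> \<le> B * indicator (cball 0 R) x"
    using C1c_bounds[OF assms R] by metis
  show "integrable lborel f" "integrable lborel (\<lambda>x. f' x v)"
    using B C1c_borel[OF assms]
    by (auto intro!: Bochner_Integration.integrable_bound[OF integrable_indicator_cball[of B R]])
qed

lemma has_derivative_line:
  fixes f :: "'a::euclidean_space \<Rightarrow> real"
  assumes "(f has_derivative f') (at (x + t *\<^sub>R v))"
  shows "((\<lambda>t. f (x + t *\<^sub>R v)) has_real_derivative f' v) (at t)"
proof -
  have "((\<lambda>t. f (x + t *\<^sub>R v)) has_derivative (\<lambda>h. f' (h *\<^sub>R v))) (at t)"
    using assms by (intro has_derivative_compose[of "\<lambda>t. x + t *\<^sub>R v" "\<lambda>h. h *\<^sub>R v" t UNIV f f'])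
      (auto intro!: derivative_eq_intros)
  moreover have "f' (h *\<^sub>R v) = f' v * h" for h
    using linear_scale[OF has_derivative_linear[OF assms], of h v] by simp
  ultimately show ?thesis by (simp add: has_field_derivative_def)
qed

lemma difference_quotient_bound:
  fixes f :: "'a::euclidean_space \<Rightarrow> real"
  assumes "\<And>x. (f has_derivative f' x) (at x)" "\<And>x. \<bar>f' x v\<bar> \<le> B" "0 < t"
  shows "\<bar>(f (x + t *\<^sub>R v) - f x) / t\<bar> \<le> B"
proof -
  have "norm (f (x + t *\<^sub>R v) - f (x + 0 *\<^sub>R v)) \<le> B * norm (t - 0)"
    using assms(2) has_derivative_line[OF assms(1)]
    by (intro field_differentiable_bound[of UNIV "\<lambda>t. f (x + t *\<^sub>R v)" "\<lambda>t. f' (x + t *\<^sub>R v) v"]) auto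
  then show ?thesis using assms(3) by (simp add: field_simps)
qed

lemma difference_quotient_tendsto:
  fixes f :: "'a::euclidean_space \<Rightarrow> real"
  assumes "(f has_derivative f') (at x)" "\<And>n. 0 < t n" "t \<longlonglongrightarrow> 0"
  shows "(\<lambda>n. (f (x + t n *\<^sub>R v) - f x) / t n) \<longlonglongrightarrow> f' v"
proof -
  have "((\<lambda>t. f (x + t *\<^sub>R v)) has_real_derivative f' v) (at 0)"
    using assms(1) by (intro has_derivative_line) simp
  then have "((\<lambda>h. (f (x + h *\<^sub>R v) - f x) / h) \<longlongrightarrow> f' v) (at 0)"
    by (simp add: has_field_derivative_iff)
  moreover have "filterlim t (at 0) sequentially"
    using assms(2,3) by (auto simp: filterlim_at less_imp_neq[symmetric])
  ultimately show ?thesis by (rule filterlim_compose)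
qed

text \<open>One integrable bound for all steps t \<le> 1, as dominated convergence requires: the
  mean value inequality gives the height, and the shift by t v enlarges the support by at most
  \<open>norm v\<close>.\<close>

lemma C1c_difference_quotient_bound:
  fixes f :: "'a::euclidean_space \<Rightarrow> real"
  assumes f: "C1c f f'" and R: "\<And>x. f x \<noteq> 0 \<Longrightarrow> norm x \<le> R"
  obtains B where "0 \<le> B"
    "\<And>x t. 0 < t \<Longrightarrow> t \<le> 1 \<Longrightarrow> \<bar>(f (x + t *\<^sub>R v) - f x) / t\<bar> \<le> B * indicator (cball 0 (R + norm v)) x"
proof -
  obtain B where B: "0 \<le> B" "\<And>x. \<bar>f x\<bar> \<le> B * indicator (cball 0 R) x"
    "\<And>x. \<bar>f' x v\<bar> \<le> B * indicator (cball 0 R) x"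
    using C1c_bounds[OF f R] by metis
  have B': "\<bar>f' x v\<bar> \<le> B" for x using le_mult_indicatorD[OF B(3) B(1)] .
  have d: "(f has_derivative f' x) (at x)" for x using f by (simp add: C1c_def)
  have "\<bar>(f (x + t *\<^sub>R v) - f x) / t\<bar> \<le> B * indicator (cball 0 (R + norm v)) x"
    if t: "0 < t" "t \<le> 1" for x t
  proof (cases "norm x \<le> R + norm v")
    case True
    then show ?thesis using difference_quotient_bound[OF d B' t(1)] by simp
  next
    case False
    have "norm x \<le> norm (x + t *\<^sub>R v) + norm (t *\<^sub>R v)"
      using norm_triangle_ineq4[of "x + t *\<^sub>R v" "t *\<^sub>R v"] by simp
    moreover have "norm (t *\<^sub>R v) \<le> norm v"
      using t by (simp add: mult_left_le_one_le)
    ultimately have "f (x + t *\<^sub>R v) = 0" "f x = 0"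
      using False R[of "x + t *\<^sub>R v"] R[of x] norm_ge_zero[of v] by linarith+
    then show ?thesis using B(1) by simp
  qed
  with B(1) show thesis by (rule that)
qed

text \<open>Translation invariance makes the integral of every difference quotient vanish.\<close>

lemma C1c_integral_derivative:
  fixes f :: "'a::euclidean_space \<Rightarrow> real"
  assumes f: "C1c f f'"
  shows "(\<integral>x. f' x v \<partial>lborel) = 0"
proof -
  obtain R where R: "\<And>x. f x \<noteq> 0 \<Longrightarrow> norm x \<le> R" using f by (auto simp: C1c_def)
  obtain B where B: "\<And>x t. 0 < t \<Longrightarrow> t \<le> 1 \<Longrightarrow>
      \<bar>(f (x + t *\<^sub>R v) - f x) / t\<bar> \<le> B * indicator (cball 0 (R + norm v)) x"
    using C1c_difference_quotient_bound[OF f R] by metis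
  define t :: "nat \<Rightarrow> real" where "t n = 1 / Suc n" for n
  have t: "0 < t n" "t n \<le> 1" for n by (auto simp: t_def)
  have t0: "t \<longlonglongrightarrow> 0" unfolding t_def by (rule LIMSEQ_Suc[OF lim_1_over_n])
  have d: "(f has_derivative f' x) (at x)" for x using f by (simp add: C1c_def)
  note [measurable] = C1c_borel[OF f]
  have "(\<lambda>n. \<integral>x. (f (x + t n *\<^sub>R v) - f x) / t n \<partial>lborel) \<longlonglongrightarrow> (\<integral>x. f' x v \<partial>lborel)"
  proof (rule integral_dominated_convergence[where w="\<lambda>x. B * indicator (cball 0 (R + norm v)) x"])
    show "AE x in lborel. (\<lambda>n. (f (x + t n *\<^sub>R v) - f x) / t n) \<longlonglongrightarrow> f' x v"
      using difference_quotient_tendsto[OF d t(1) t0] by simp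
    show "AE x in lborel. norm ((f (x + t n *\<^sub>R v) - f x) / t n) \<le> B * indicator (cball 0 (R + norm v)) x" for n
      using B[OF t] by simp
  qed (use integrable_indicator_cball in auto)
  moreover have "(\<lambda>n. \<integral>x. (f (x + t n *\<^sub>R v) - f x) / t n \<partial>lborel) = (\<lambda>n. 0)"
    using integral_lborel_shift[of f "t n *\<^sub>R v" for n] C1c_integrable[OF f] by (simp add: fun_eq_iff)
  ultimately have "(\<lambda>n::nat. 0) \<longlonglongrightarrow> (\<integral>x. f' x v \<partial>lborel)" by (simp only:)
  then show ?thesis by (simp add: LIMSEQ_const_iff)
qed

lemma C1c_mult:
  assumes "C1c f f'" "C1c h h'"
  shows "C1c (\<lambda>x. f x * h x) (\<lambda>x v. f x * h' x v + f' x v * h x)"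
  unfolding C1c_def
proof (intro conjI allI)
  show "((\<lambda>x. f x * h x) has_derivative (\<lambda>v. f x * h' x v + f' x v * h x)) (at x)" for x
    using assms by (intro has_derivative_mult) (auto simp: C1c_def)
  show "continuous_on UNIV (\<lambda>x. f x * h' x v + f' x v * h x)" for v
    using C1c_continuous[OF assms(1)] C1c_continuous[OF assms(2)] assms
    by (intro continuous_on_add continuous_on_mult) (auto simp: C1c_def)
  show "\<exists>R. \<forall>x. f x * h x \<noteq> 0 \<longrightarrow> norm x \<le> R"
    using assms(1) by (auto simp: C1c_def)
qed

text \<open>The product is again of class \<open>C^1\<close> with bounded support, so the integral
  of its directional derivative vanishes; the product rule splits that integral.\<close>

lemma C1c_integration_by_parts:
  fixes f h :: "'a::euclidean_space \<Rightarrow> real"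
  assumes f: "C1c f f'" and h: "C1c h h'"
  shows "(\<integral>x. f' x v * h x \<partial>lborel) = - (\<integral>x. f x * h' x v \<partial>lborel)"
proof -
  have bd: "\<exists>B. \<forall>x. \<bar>f x\<bar> \<le> B \<and> \<bar>f' x v\<bar> \<le> B"
  proof -
    obtain R where R: "\<And>x. f x \<noteq> 0 \<Longrightarrow> norm x \<le> R" using f by (auto simp: C1c_def)
    obtain B where B: "0 \<le> B" "\<And>x. \<bar>f x\<bar> \<le> B * indicator (cball 0 R) x"
      "\<And>x. \<bar>f' x v\<bar> \<le> B * indicator (cball 0 R) x"
      using C1c_bounds[OF f R] by metis
    show ?thesis
      using le_mult_indicatorD[OF B(2) B(1)] le_mult_indicatorD[OF B(3) B(1)] by blast
  qed
  then obtain B where B: "\<And>x. \<bar>f x\<bar> \<le> B" "\<And>x. \<bar>f' x v\<bar> \<le> B" by blast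
  note [measurable] = C1c_borel[OF f] C1c_borel[OF h]
  have "integrable lborel (\<lambda>x. f x * h' x v)"
    by (rule integrable_bounded_mult[OF C1c_integrable(2)[OF h] _ B(1)]) measurable
  moreover have "integrable lborel (\<lambda>x. f' x v * h x)"
    by (rule integrable_bounded_mult[OF C1c_integrable(1)[OF h] _ B(2)]) measurable
  moreover have "(\<integral>x. f x * h' x v + f' x v * h x \<partial>lborel) = 0"
    using C1c_integral_derivative[OF C1c_mult[OF f h]] .
  ultimately show ?thesis by simp
qed

lemma C1c_shift:
  assumes "C1c f f'"
  shows "C1c (\<lambda>x. f (x - y)) (\<lambda>x. f' (x - y))"
  unfolding C1c_def
proof (intro conjI allI)
  show "((\<lambda>x. f (x - y)) has_derivative f' (x - y)) (at x)" for x
  proof -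
    have "((\<lambda>x. x - y) has_derivative (\<lambda>h. h)) (at x)" by (auto intro!: derivative_eq_intros)
    moreover have "(f has_derivative f' (x - y)) (at (x - y))" using assms by (simp add: C1c_def)
    ultimately show ?thesis by (rule has_derivative_compose)
  qed
  show "continuous_on UNIV (\<lambda>x. f' (x - y) v)" for v
  proof -
    have "continuous_on UNIV (\<lambda>x. x - y)" by (intro continuous_intros)
    moreover have "continuous_on UNIV (\<lambda>x. f' x v)" using assms by (simp add: C1c_def)
    ultimately show ?thesis using continuous_on_compose2[of UNIV "\<lambda>x. f' x v" UNIV "\<lambda>x. x - y"] by simp
  qed
  obtain R where R: "\<And>x. f x \<noteq> 0 \<Longrightarrow> norm x \<le> R" using assms by (auto simp: C1c_def)
  show "\<exists>R. \<forall>x. f (x - y) \<noteq> 0 \<longrightarrow> norm x \<le> R"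
  proof (intro exI[of _ "R + norm y"] allI impI)
    fix x assume "f (x - y) \<noteq> 0"
    then show "norm x \<le> R + norm y" using R[of "x - y"] norm_triangle_sub[of x y] by simp
  qed
qed

subsection \<open>Mollification\<close>

text \<open>A predicate on all admissible kernels with support in the ball of radius
  \<open>r\<close>, rather than rescalings of one fixed kernel: this is what makes the set of
  kernels convex.\<close>

definition mollifier :: "real \<Rightarrow> ('a::euclidean_space \<Rightarrow> real) \<Rightarrow> ('a \<Rightarrow> 'a \<Rightarrow> real) \<Rightarrow> bool" where
  "mollifier r \<rho> \<rho>' \<longleftrightarrow> C1c \<rho> \<rho>' \<and> (\<forall>x. 0 \<le> \<rho> x) \<and> (\<forall>x. \<rho> x \<noteq> 0 \<longrightarrow> norm x \<le> r) \<and>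
     (\<integral>x. \<rho> x \<partial>lborel) = 1"

text \<open>Borel rather than Lebesgue measurability is required, so that (x, y) \<mapsto> h (x - y)
  u y is jointly measurable.\<close>

definition loc_int :: "('a::euclidean_space \<Rightarrow> real) \<Rightarrow> bool" where
  "loc_int u \<longleftrightarrow> u \<in> borel_measurable borel \<and> (\<forall>R. integrable lborel (\<lambda>x. indicator (cball 0 R) x * u x))"

definition conv :: "('a::euclidean_space \<Rightarrow> real) \<Rightarrow> ('a \<Rightarrow> real) \<Rightarrow> 'a \<Rightarrow> real" where
  "conv h u x = (\<integral>y. h (x - y) * u y \<partial>lborel)"

text \<open>Since convolution is linear in the kernel, this makes the partial derivatives of
  mollifications at a given scale closed under midpoints, as the minimisation needs.\<close>

lemma mollifier_midpoint:
  assumes "mollifier r \<rho> \<rho>'" "mollifier r \<sigma> \<sigma>'"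
  shows "mollifier r (\<lambda>x. (\<rho> x + \<sigma> x) / 2) (\<lambda>x v. (\<rho>' x v + \<sigma>' x v) / 2)"
  unfolding mollifier_def C1c_def
proof (intro conjI allI impI)
  have C: "C1c \<rho> \<rho>'" "C1c \<sigma> \<sigma>'" using assms by (auto simp: mollifier_def)
  show "((\<lambda>x. (\<rho> x + \<sigma> x) / 2) has_derivative (\<lambda>v. (\<rho>' x v + \<sigma>' x v) / 2)) (at x)" for x
  proof -
    have "((\<lambda>x. (1/2) *\<^sub>R (\<rho> x + \<sigma> x)) has_derivative (\<lambda>v. (1/2) *\<^sub>R (\<rho>' x v + \<sigma>' x v))) (at x)"
      using C by (intro has_derivative_scaleR_right has_derivative_add) (auto simp: C1c_def)
    then show ?thesis by simp
  qed
  show "continuous_on UNIV (\<lambda>x. (\<rho>' x v + \<sigma>' x v) / 2)" for v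
    using C by (intro continuous_on_divide continuous_on_add) (auto simp: C1c_def)
  have supp: "norm x \<le> r" if "(\<rho> x + \<sigma> x) / 2 \<noteq> 0" for x
    using that assms unfolding mollifier_def by (metis add.right_neutral div_0)
  then show "\<exists>R. \<forall>x. (\<rho> x + \<sigma> x) / 2 \<noteq> 0 \<longrightarrow> norm x \<le> R" by blast
  show "norm x \<le> r" if "(\<rho> x + \<sigma> x) / 2 \<noteq> 0" for x using supp[OF that] .
  show "0 \<le> (\<rho> x + \<sigma> x) / 2" for x using assms by (auto simp: mollifier_def)
  show "(\<integral>x. (\<rho> x + \<sigma> x) / 2 \<partial>lborel) = 1"
    using assms C1c_integrable(1)[OF C(1)] C1c_integrable(1)[OF C(2)] by (simp add: mollifier_def)
qed

lemma mollifier_mono: "mollifier r \<rho> \<rho>' \<Longrightarrow> r \<le> r' \<Longrightarrow> mollifier r' \<rho> \<rho>'"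
  unfolding mollifier_def by (meson order_trans)

text \<open>Squaring removes the kink of the positive part: at 0 the difference quotient is at most
  |h|. This gives a bump of class \<open>C^1\<close> from a polynomial.\<close>

lemma has_real_derivative_max_square:
  "((\<lambda>t::real. (max 0 t)\<^sup>2) has_real_derivative 2 * max 0 t) (at t)"
proof -
  consider "t < 0" | "t = 0" | "0 < t" by linarith
  then show ?thesis
  proof cases
    case 1
    have "((\<lambda>t::real. 0) has_real_derivative 2 * max 0 t) (at t)" using 1 by simp
    then show ?thesis
      by (rule has_field_derivative_transform_within_open[of _ _ _ "{..<0}"]) (use 1 in auto)
  next
    case 3
    have "((\<lambda>t::real. t\<^sup>2) has_real_derivative 2 * max 0 t) (at t)"
      using 3 by (auto intro!: derivative_eq_intros)
    then show ?thesis
      by (rule has_field_derivative_transform_within_open[of _ _ _ "{0<..}"]) (use 3 in auto)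
  next
    case 2
    have "((\<lambda>h::real. (max 0 h)\<^sup>2 / h) \<longlongrightarrow> 0) (at 0)"
    proof (rule Lim_null_comparison[of _ "\<lambda>h. \<bar>h\<bar>"])
      show "\<forall>\<^sub>F h in at 0. norm ((max 0 h)\<^sup>2 / h) \<le> \<bar>h::real\<bar>"
        by (intro always_eventually allI) (auto simp: max_def power2_eq_square)
      show "((\<lambda>h::real. \<bar>h\<bar>) \<longlongrightarrow> 0) (at 0)" by (intro tendsto_eq_intros) auto
    qed
    then show ?thesis using 2 by (simp add: has_field_derivative_iff)
  qed
qed

lemma mollifier_exists:
  assumes "0 < r"
  obtains \<rho> :: "'a::euclidean_space \<Rightarrow> real" and \<rho>' where "mollifier r \<rho> \<rho>'"
proof -
  \<comment> \<open>The square of the positive part of r^2 - |x|^2, which vanishes outside the ball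
    of radius \<open>r\<close>; it is normalised by \<open>c\<close> below.\<close>
  define f :: "'a \<Rightarrow> real" where "f x = (max 0 (r\<^sup>2 - x \<bullet> x))\<^sup>2" for x
  define f' :: "'a \<Rightarrow> 'a \<Rightarrow> real" where "f' x v = 2 * max 0 (r\<^sup>2 - x \<bullet> x) * (- (2 * (x \<bullet> v)))" for x v
  have d: "(f has_derivative f' x) (at x)" for x
  proof -
    have "((\<lambda>x. r\<^sup>2 - x \<bullet> x) has_derivative (\<lambda>v. - (2 * (x \<bullet> v)))) (at x)"
      by (auto intro!: derivative_eq_intros simp: inner_commute)
    moreover have "((\<lambda>t::real. (max 0 t)\<^sup>2) has_derivative (*) (2 * max 0 (r\<^sup>2 - x \<bullet> x))) (at (r\<^sup>2 - x \<bullet> x))"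
      using has_real_derivative_max_square by (simp add: has_field_derivative_def)
    ultimately show ?thesis unfolding f_def f'_def by (rule has_derivative_compose)
  qed
  have supp: "norm x \<le> r" if "f x \<noteq> 0" for x
  proof (rule ccontr)
    assume "\<not> norm x \<le> r"
    then have "r\<^sup>2 \<le> (norm x)\<^sup>2" using assms by (intro power_mono) auto
    then have "f x = 0" by (simp add: f_def power2_norm_eq_inner)
    with that show False by simp
  qed
  have cont: "continuous_on UNIV (\<lambda>x. f' x v)" for v
    unfolding f'_def by (intro continuous_intros)
  have C: "C1c f f'" unfolding C1c_def using d cont supp by blast
  have f0: "0 \<le> f x" for x by (simp add: f_def)
  \<comment> \<open>The bump is positive on the open ball, so a zero integral would make that ball
    negligible.\<close>
  have "(\<integral>x. f x \<partial>lborel) \<noteq> 0"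
  proof
    assume "(\<integral>x. f x \<partial>lborel) = 0"
    then have ae: "AE x in lborel. f x = 0"
      using integral_nonneg_eq_0_iff_AE[OF C1c_integrable(1)[OF C]] f0 by simp
    have "AE x in lborel. x \<notin> ball (0::'a) r"
      using ae
    proof eventually_elim
      case (elim x)
      show ?case
      proof
        assume "x \<in> ball 0 r"
        then have "(norm x)\<^sup>2 < r\<^sup>2" by (intro power_strict_mono) auto
        then have "0 < f x" by (simp add: f_def power2_norm_eq_inner max_def)
        with elim show False by simp
      qed
    qed
    then have "emeasure lborel (ball (0::'a) r) = 0"
      by (subst (asm) AE_iff_measurable[of "ball (0::'a) r"]) auto
    then have "ball (0::'a) r \<in> null_sets lebesgue" by (auto simp: null_sets_def)
    then show False using open_not_negligible[of "ball (0::'a) r"] assms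
      by (simp add: negligible_iff_null_sets)
  qed
  moreover have "0 \<le> (\<integral>x. f x \<partial>lborel)" using f0 by simp
  ultimately have I: "0 < (\<integral>x. f x \<partial>lborel)" by linarith
  define c where "c = 1 / (\<integral>x. f x \<partial>lborel)"
  have c: "0 < c" using I by (simp add: c_def)
  have "mollifier r (\<lambda>x. c * f x) (\<lambda>x v. c * f' x v)"
    unfolding mollifier_def C1c_def
  proof (intro conjI allI impI)
    show "((\<lambda>x. c * f x) has_derivative (\<lambda>v. c * f' x v)) (at x)" for x
      by (intro has_derivative_mult_right d)
    show "continuous_on UNIV (\<lambda>x. c * f' x v)" for v by (intro continuous_on_mult_left cont)
    show "\<exists>R. \<forall>x. c * f x \<noteq> 0 \<longrightarrow> norm x \<le> R" using supp by (intro exI[of _ r]) auto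
    show "norm x \<le> r" if "c * f x \<noteq> 0" for x using supp that by auto
    show "0 \<le> c * f x" for x using c f0 by simp
    show "(\<integral>x. c * f x \<partial>lborel) = 1" using I by (simp add: c_def)
  qed
  then show thesis by (rule that)
qed

lemma conv_commute:
  assumes [measurable]: "h \<in> borel_measurable borel" "u \<in> borel_measurable borel"
  shows "conv h u x = (\<integral>t. h t * u (x - t) \<partial>lborel)"
  using integral_lborel_reflect(1)[of "\<lambda>y. h (x - y) * u y" x] by (simp add: conv_def)

lemma conv_borel [measurable]:
  assumes [measurable]: "h \<in> borel_measurable borel" "u \<in> borel_measurable borel"
  shows "conv h u \<in> borel_measurable borel"
  unfolding conv_def[abs_def] by measurable

text \<open>If x - y lies in the ball of radius \<open>R\<close>, then \<open>y\<close> lies in the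
  ball of radius R + |x|, where \<open>u\<close> is integrable.\<close>

lemma conv_integrable:
  fixes u :: "'a::euclidean_space \<Rightarrow> real"
  assumes u: "loc_int u" and [measurable]: "h \<in> borel_measurable borel"
    and h: "\<And>x. \<bar>h x\<bar> \<le> B * indicator (cball 0 R) x"
  shows "integrable lborel (\<lambda>y. h (x - y) * u y)" "integrable lborel (\<lambda>t. h t * u (x - t))"
proof -
  have [measurable]: "u \<in> borel_measurable borel" using u by (simp add: loc_int_def)
  show 1: "integrable lborel (\<lambda>y. h (x - y) * u y)"
  proof (rule Bochner_Integration.integrable_bound[where f="\<lambda>y. B * (indicator (cball 0 (R + norm x)) y * u y)"])
    show "integrable lborel (\<lambda>y. B * (indicator (cball 0 (R + norm x)) y * u y))"
      using u by (auto simp: loc_int_def)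
    have "\<bar>h (x - y) * u y\<bar> \<le> \<bar>B * (indicator (cball 0 (R + norm x)) y * u y)\<bar>" for y
    proof -
      have "\<bar>h (x - y) * u y\<bar> \<le> B * indicator (cball 0 R) (x - y) * \<bar>u y\<bar>"
        unfolding abs_mult by (intro mult_right_mono h) auto
      also have "\<dots> \<le> \<bar>B\<bar> * indicator (cball 0 (R + norm x)) y * \<bar>u y\<bar>"
      proof (intro mult_right_mono)
        have "norm y \<le> R + norm x" if "norm (x - y) \<le> R"
          using that norm_triangle_ineq4[of x "x - y"] by simp
        then show "B * indicator (cball 0 R) (x - y) \<le> \<bar>B\<bar> * indicator (cball 0 (R + norm x)) y"
          by (auto simp: indicator_def)
      qed auto
      finally show ?thesis by (simp add: abs_mult)
    qed
    then show "AE y in lborel. norm (h (x - y) * u y) \<le> norm (B * (indicator (cball 0 (R + norm x)) y * u y))"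
      by simp
  qed measurable
  show "integrable lborel (\<lambda>t. h t * u (x - t))"
    using integral_lborel_reflect(2)[of "\<lambda>y. h (x - y) * u y" x] 1 by simp
qed

lemma C1c_conv_integrable:
  fixes u :: "'a::euclidean_space \<Rightarrow> real"
  assumes u: "loc_int u" and \<rho>: "C1c \<rho> \<rho>'"
  shows "integrable lborel (\<lambda>y. \<rho> (x - y) * u y)" "integrable lborel (\<lambda>y. \<rho>' (x - y) v * u y)"
    "integrable lborel (\<lambda>t. \<rho> t * u (x - t))"
proof -
  obtain R where R: "\<And>x. \<rho> x \<noteq> 0 \<Longrightarrow> norm x \<le> R" using \<rho> by (auto simp: C1c_def)
  obtain B where B: "\<And>x. \<bar>\<rho> x\<bar> \<le> B * indicator (cball 0 R) x"
    "\<And>x. \<bar>\<rho>' x v\<bar> \<le> B * indicator (cball 0 R) x"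
    using C1c_bounds[OF \<rho> R] by metis
  show "integrable lborel (\<lambda>y. \<rho> (x - y) * u y)" "integrable lborel (\<lambda>y. \<rho>' (x - y) v * u y)"
    "integrable lborel (\<lambda>t. \<rho> t * u (x - t))"
    using conv_integrable[OF u C1c_borel(1)[OF \<rho>] B(1)] conv_integrable[OF u C1c_borel(2)[OF \<rho>] B(2)] by auto
qed

text \<open>The difference quotient falls on the kernel, where it converges pointwise under a bound
  with compact support. Nothing but local integrability is asked of \<open>u\<close>.\<close>

lemma conv_difference_quotient_tendsto:
  fixes u :: "'a::euclidean_space \<Rightarrow> real"
  assumes u: "loc_int u" and \<rho>: "C1c \<rho> \<rho>'" and t: "\<And>n. 0 < t n" "\<And>n. t n \<le> 1" "t \<longlonglongrightarrow> 0"
  shows "(\<lambda>n. (conv \<rho> u (x + t n *\<^sub>R v) - conv \<rho> u x) / t n) \<longlonglongrightarrow> conv (\<lambda>x. \<rho>' x v) u x"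
proof -
  obtain R where R: "\<And>x. \<rho> x \<noteq> 0 \<Longrightarrow> norm x \<le> R" using \<rho> by (auto simp: C1c_def)
  obtain B where B: "\<And>x t. 0 < t \<Longrightarrow> t \<le> 1 \<Longrightarrow>
      \<bar>(\<rho> (x + t *\<^sub>R v) - \<rho> x) / t\<bar> \<le> B * indicator (cball 0 (R + norm v)) x"
    using C1c_difference_quotient_bound[OF \<rho> R] by metis
  have d: "(\<rho> has_derivative \<rho>' x) (at x)" for x using \<rho> by (simp add: C1c_def)
  note [measurable] = C1c_borel[OF \<rho>]
  have [measurable]: "u \<in> borel_measurable borel" using u by (simp add: loc_int_def)
  have eq: "(conv \<rho> u (x + t n *\<^sub>R v) - conv \<rho> u x) / t n
    = (\<integral>y. (\<rho> ((x - y) + t n *\<^sub>R v) - \<rho> (x - y)) / t n * u y \<partial>lborel)" for n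
  proof -
    have "(conv \<rho> u (x + t n *\<^sub>R v) - conv \<rho> u x) / t n
      = (\<integral>y. (\<rho> (x + t n *\<^sub>R v - y) * u y - \<rho> (x - y) * u y) / t n \<partial>lborel)"
      unfolding conv_def using C1c_conv_integrable(1)[OF u \<rho>] by simp
    also have "\<dots> = (\<integral>y. (\<rho> ((x - y) + t n *\<^sub>R v) - \<rho> (x - y)) / t n * u y \<partial>lborel)"
      by (intro Bochner_Integration.integral_cong) (auto simp: algebra_simps diff_divide_distrib)
    finally show ?thesis .
  qed
  show ?thesis
    unfolding eq unfolding conv_def
  proof (rule integral_dominated_convergence[where w="\<lambda>y. norm (B * indicator (cball 0 (R + norm v)) (x - y) * u y)"])
    show "integrable lborel (\<lambda>y. norm (B * indicator (cball 0 (R + norm v)) (x - y) * u y))"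
    proof (intro integrable_norm conv_integrable(1)[OF u, where B="\<bar>B\<bar>" and R="R + norm v"
          and h="\<lambda>z. B * indicator (cball 0 (R + norm v)) z"])
      show "\<bar>B * indicator (cball 0 (R + norm v)) z\<bar> \<le> \<bar>B\<bar> * indicator (cball 0 (R + norm v)) z" for z :: 'a
        by (simp add: abs_mult)
    qed measurable
    show "AE y in lborel. (\<lambda>n. (\<rho> ((x - y) + t n *\<^sub>R v) - \<rho> (x - y)) / t n * u y) \<longlonglongrightarrow> \<rho>' (x - y) v * u y"
      by (intro always_eventually allI tendsto_mult tendsto_const difference_quotient_tendsto d t)
    show "AE y in lborel. norm ((\<rho> ((x - y) + t n *\<^sub>R v) - \<rho> (x - y)) / t n * u y)
        \<le> norm (B * indicator (cball 0 (R + norm v)) (x - y) * u y)" for n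
      unfolding norm_mult[of _ "u _"]
      using order_trans[OF B[OF t(1) t(2)] abs_ge_self]
      by (intro always_eventually allI mult_right_mono) auto
  qed measurable
qed

lemma conv_derivative_linear:
  fixes u :: "'a::euclidean_space \<Rightarrow> real"
  assumes u: "loc_int u" and \<rho>: "C1c \<rho> \<rho>'"
  shows "linear (\<lambda>v. conv (\<lambda>x. \<rho>' x v) u x)"
proof -
  have lin: "linear (\<rho>' x)" for x using \<rho> by (auto simp: C1c_def intro: has_derivative_linear)
  show ?thesis
    unfolding conv_def
    by (rule linearI)
      (simp_all add: linear_add[OF lin] linear_scale[OF lin] distrib_right C1c_conv_integrable(2)[OF u \<rho>] mult.assoc)
qed

subsection \<open>The energy of a mollification\<close>

text \<open>The measure with density \<rho> is a probability measure. If the right side is infinite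
  there is nothing to prove; otherwise it supplies the integrability that Jensen's inequality
  needs.\<close>

lemma jensen_mollifier:
  fixes \<Gamma> :: "real \<Rightarrow> real"
  assumes \<rho>: "mollifier r \<rho> \<rho>'" and \<Gamma>: "convex_on UNIV \<Gamma>" "\<And>t. 0 \<le> \<Gamma> t"
    and [measurable]: "\<Gamma> \<in> borel_measurable borel" "X \<in> borel_measurable borel"
    and X: "integrable lborel (\<lambda>t. \<rho> t * X t)"
  shows "ennreal (\<Gamma> (\<integral>t. \<rho> t * X t \<partial>lborel)) \<le> (\<integral>\<^sup>+t. ennreal (\<rho> t) * ennreal (\<Gamma> (X t)) \<partial>lborel)"
proof (cases "(\<integral>\<^sup>+t. ennreal (\<rho> t) * ennreal (\<Gamma> (X t)) \<partial>lborel) = \<infinity>")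
  case False
  have C: "C1c \<rho> \<rho>'" and \<rho>0: "\<And>x. 0 \<le> \<rho> x" and I: "(\<integral>x. \<rho> x \<partial>lborel) = 1"
    using \<rho> by (auto simp: mollifier_def)
  note [measurable] = C1c_borel[OF C]
  let ?M = "density lborel (\<lambda>x. ennreal (\<rho> x))"
  interpret prob_space ?M
  proof
    have "(\<integral>\<^sup>+x. ennreal (\<rho> x) \<partial>lborel) = 1"
      using nn_integral_eq_integral[OF C1c_integrable(1)[OF C]] \<rho>0 I by simp
    then show "emeasure ?M (space ?M) = 1" by (simp add: emeasure_density)
  qed
  have eq: "ennreal (\<rho> t) * ennreal (\<Gamma> (X t)) = ennreal (\<rho> t * \<Gamma> (X t))" for t
    using \<rho>0 \<Gamma>(2) by (simp add: ennreal_mult)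
  have int: "integrable lborel (\<lambda>t. \<rho> t * \<Gamma> (X t))"
    using False \<rho>0 \<Gamma>(2) unfolding eq by (intro integrableI_nonneg) (auto simp: less_top)
  have "\<Gamma> (expectation X) \<le> expectation (\<lambda>x. \<Gamma> (X x))"
    using X int \<rho>0 \<Gamma> by (intro jensens_inequality[where I=UNIV]) (auto simp: integrable_density)
  moreover have "expectation X = (\<integral>t. \<rho> t * X t \<partial>lborel)"
    using \<rho>0 by (simp add: integral_density)
  moreover have "expectation (\<lambda>x. \<Gamma> (X x)) = (\<integral>t. \<rho> t * \<Gamma> (X t) \<partial>lborel)"
    using \<rho>0 by (simp add: integral_density)
  ultimately have "ennreal (\<Gamma> (\<integral>t. \<rho> t * X t \<partial>lborel)) \<le> ennreal (\<integral>t. \<rho> t * \<Gamma> (X t) \<partial>lborel)"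
    by (simp add: ennreal_leI)
  also have "\<dots> = (\<integral>\<^sup>+t. ennreal (\<rho> t) * ennreal (\<Gamma> (X t)) \<partial>lborel)"
    unfolding eq using int \<rho>0 \<Gamma>(2) by (intro nn_integral_eq_integral[symmetric]) auto
  finally show ?thesis .
qed simp

text \<open>The weights \<open>a\<close> and \<open>b\<close> depend on the increment
  \<open>h\<close> only, so every translate of \<open>u\<close> has the same energy, and Jensen
  bounds the energy of the mollification by a \<rho>-average of these. The energy of the theorem has
  a h = |h|^s and b h = |h|^(-N) on the ball of radius \<delta>.\<close>

lemma energy_conv_le:
  fixes u :: "'a::euclidean_space \<Rightarrow> real" and \<Gamma> :: "real \<Rightarrow> real" and a :: "'a \<Rightarrow> real" and b :: "'a \<Rightarrow> ennreal"
  assumes \<rho>: "mollifier r \<rho> \<rho>'" and u: "loc_int u"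
    and \<Gamma>: "convex_on UNIV \<Gamma>" "\<And>t. 0 \<le> \<Gamma> t"
    and [measurable]: "\<Gamma> \<in> borel_measurable borel" "a \<in> borel_measurable borel" "b \<in> borel_measurable borel"
  shows "(\<integral>\<^sup>+x. \<integral>\<^sup>+h. ennreal (\<Gamma> ((conv \<rho> u (x + h) - conv \<rho> u x) / a h)) * b h \<partial>lborel \<partial>lborel)
    \<le> (\<integral>\<^sup>+x. \<integral>\<^sup>+h. ennreal (\<Gamma> ((u (x + h) - u x) / a h)) * b h \<partial>lborel \<partial>lborel)"
proof -
  have C: "C1c \<rho> \<rho>'" and \<rho>0: "\<And>x. 0 \<le> \<rho> x" and I: "(\<integral>x. \<rho> x \<partial>lborel) = 1"
    using \<rho> by (auto simp: mollifier_def)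
  note [measurable] = C1c_borel[OF C]
  have [measurable]: "u \<in> borel_measurable borel" using u by (simp add: loc_int_def)
  define k where "k x h = ennreal (\<Gamma> ((u (x + h) - u x) / a h)) * b h" for x h
  have [measurable]: "(\<lambda>z. k (f z) (g z)) \<in> borel_measurable M"
    if [measurable]: "f \<in> measurable M borel" "g \<in> measurable M borel" for f g and M :: "'c measure"
    unfolding k_def by measurable
  have shift: "(\<integral>\<^sup>+x. \<integral>\<^sup>+h. k (x - t) h \<partial>lborel \<partial>lborel) = (\<integral>\<^sup>+x. \<integral>\<^sup>+h. k x h \<partial>lborel \<partial>lborel)" for t
    using nn_integral_lborel_shift[of "\<lambda>x. \<integral>\<^sup>+h. k x h \<partial>lborel" "- t"] by simp
  have J: "ennreal (\<Gamma> ((conv \<rho> u (x + h) - conv \<rho> u x) / a h)) * b h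
      \<le> (\<integral>\<^sup>+t. ennreal (\<rho> t) * k (x - t) h \<partial>lborel)" for x h
  proof -
    have int: "integrable lborel (\<lambda>t. \<rho> t * ((u (x + h - t) - u (x - t)) / a h))"
    proof -
      have "integrable lborel (\<lambda>t. (\<rho> t * u (x + h - t) - \<rho> t * u (x - t)) / a h)"
        using C1c_conv_integrable(3)[OF u C] by simp
      then show ?thesis by (simp add: algebra_simps)
    qed
    have "(conv \<rho> u (x + h) - conv \<rho> u x) / a h
      = (\<integral>t. (\<rho> t * u (x + h - t) - \<rho> t * u (x - t)) / a h \<partial>lborel)"
      using C1c_conv_integrable(3)[OF u C] by (simp add: conv_commute)
    also have "\<dots> = (\<integral>t. \<rho> t * ((u (x + h - t) - u (x - t)) / a h) \<partial>lborel)"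
      by (simp add: algebra_simps)
    finally have eq: "(conv \<rho> u (x + h) - conv \<rho> u x) / a h
      = (\<integral>t. \<rho> t * ((u (x + h - t) - u (x - t)) / a h) \<partial>lborel)" .
    have "ennreal (\<Gamma> ((conv \<rho> u (x + h) - conv \<rho> u x) / a h))
      \<le> (\<integral>\<^sup>+t. ennreal (\<rho> t) * ennreal (\<Gamma> ((u (x + h - t) - u (x - t)) / a h)) \<partial>lborel)"
      unfolding eq by (rule jensen_mollifier[OF \<rho> \<Gamma> _ _ int]) measurable
    then have "ennreal (\<Gamma> ((conv \<rho> u (x + h) - conv \<rho> u x) / a h)) * b h
      \<le> (\<integral>\<^sup>+t. ennreal (\<rho> t) * ennreal (\<Gamma> ((u (x + h - t) - u (x - t)) / a h)) \<partial>lborel) * b h"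
      by (rule mult_right_mono) simp
    also have "\<dots> = (\<integral>\<^sup>+t. ennreal (\<rho> t) * k (x - t) h \<partial>lborel)"
      by (subst nn_integral_multc[symmetric]) (auto simp: k_def algebra_simps)
    finally show ?thesis .
  qed
  have "(\<integral>\<^sup>+x. \<integral>\<^sup>+h. ennreal (\<Gamma> ((conv \<rho> u (x + h) - conv \<rho> u x) / a h)) * b h \<partial>lborel \<partial>lborel)
    \<le> (\<integral>\<^sup>+x. \<integral>\<^sup>+h. \<integral>\<^sup>+t. ennreal (\<rho> t) * k (x - t) h \<partial>lborel \<partial>lborel \<partial>lborel)"
    by (intro nn_integral_mono J)
  \<comment> \<open>Two exchanges bring the translation \<open>t\<close> outermost; there the double
    integral no longer depends on it, and the integral of \<rho> contributes the factor 1.\<close>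
  also have "\<dots> = (\<integral>\<^sup>+x. \<integral>\<^sup>+t. \<integral>\<^sup>+h. ennreal (\<rho> t) * k (x - t) h \<partial>lborel \<partial>lborel \<partial>lborel)"
    by (intro nn_integral_cong lborel_pair.Fubini') measurable
  also have "\<dots> = (\<integral>\<^sup>+t. \<integral>\<^sup>+x. \<integral>\<^sup>+h. ennreal (\<rho> t) * k (x - t) h \<partial>lborel \<partial>lborel \<partial>lborel)"
    by (intro lborel_pair.Fubini') measurable
  also have "\<dots> = (\<integral>\<^sup>+t. ennreal (\<rho> t) * (\<integral>\<^sup>+x. \<integral>\<^sup>+h. k (x - t) h \<partial>lborel \<partial>lborel) \<partial>lborel)"
    by (simp add: nn_integral_cmult)
  also have "\<dots> = (\<integral>\<^sup>+t. ennreal (\<rho> t) * (\<integral>\<^sup>+x. \<integral>\<^sup>+h. k x h \<partial>lborel \<partial>lborel) \<partial>lborel)"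
    by (simp only: shift)
  also have "\<dots> = (\<integral>\<^sup>+t. ennreal (\<rho> t) \<partial>lborel) * (\<integral>\<^sup>+x. \<integral>\<^sup>+h. k x h \<partial>lborel \<partial>lborel)"
    by (simp add: nn_integral_multc)
  also have "(\<integral>\<^sup>+t. ennreal (\<rho> t) \<partial>lborel) = 1"
    using nn_integral_eq_integral[OF C1c_integrable(1)[OF C]] \<rho>0 I by simp
  finally show ?thesis by (simp add: k_def)
qed

section \<open>Lower bound of the nonlocal energy by the gradient\<close>

text \<open>Regular variation concerns a fixed factor, but here the factors |c n| vary. Eventually
  they exceed any fixed b < |l|, so monotonicity of \<open>G\<close> allows replacing them by
  \<open>b\<close>; then \<open>b\<close> increases to |l|. This stands in for uniform convergence
  of the ratios. For l = 0 the left side is 0, since \<open>0 powr p = 0\<close>.\<close>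

lemma regvar_liminf_ge:
  fixes G :: "real \<Rightarrow> real"
  assumes mono: "mono_on {0..} G" and pos: "\<And>t. 0 < t \<Longrightarrow> 0 < G t"
    and rv: "\<And>c. 0 < c \<Longrightarrow> ((\<lambda>t. G (c * t) / G t) \<longlongrightarrow> c powr p) (at_right 0)"
    and t: "\<And>n. 0 < t n" "t \<longlonglongrightarrow> 0" and c: "c \<longlonglongrightarrow> l"
  shows "ennreal (\<bar>l\<bar> powr p) \<le> liminf (\<lambda>n. ennreal (G (t n * \<bar>c n\<bar>) / G (t n)))"
proof (cases "l = 0")
  case False
  have tr: "filterlim t (at_right 0) sequentially"
    using t by (intro tendsto_imp_filterlim_at_right) auto
  have step: "ennreal (b powr p) \<le> liminf (\<lambda>n. ennreal (G (t n * \<bar>c n\<bar>) / G (t n)))"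
    if b: "0 < b" "b < \<bar>l\<bar>" for b
  proof -
    have "(\<lambda>n. G (b * t n) / G (t n)) \<longlonglongrightarrow> b powr p"
      using filterlim_compose[OF rv[OF b(1)] tr] .
    then have "(\<lambda>n. ennreal (G (b * t n) / G (t n))) \<longlonglongrightarrow> ennreal (b powr p)"
      by (rule tendsto_ennrealI)
    then have "ennreal (b powr p) = liminf (\<lambda>n. ennreal (G (b * t n) / G (t n)))"
      by (intro lim_imp_Liminf[symmetric]) auto
    also have "\<dots> \<le> liminf (\<lambda>n. ennreal (G (t n * \<bar>c n\<bar>) / G (t n)))"
    proof (rule Liminf_mono)
      have "\<forall>\<^sub>F n in sequentially. b < \<bar>c n\<bar>"
        using tendsto_rabs[OF c] b by (intro order_tendstoD)
      then show "\<forall>\<^sub>F n in sequentially. ennreal (G (b * t n) / G (t n)) \<le> ennreal (G (t n * \<bar>c n\<bar>) / G (t n))"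
      proof eventually_elim
        case (elim n)
        have "G (b * t n) \<le> G (t n * \<bar>c n\<bar>)"
          using mono t(1)[of n] elim b by (intro mono_onD[OF mono]) (auto simp: mult.commute)
        then show ?case using pos[OF t(1)[of n]] by (intro ennreal_leI divide_right_mono) auto
      qed
    qed
    finally show ?thesis .
  qed
  show ?thesis
  proof (rule tendsto_upperbound)
    have "((\<lambda>b. b powr p) \<longlongrightarrow> \<bar>l\<bar> powr p) (at_left \<bar>l\<bar>)"
      using False by (intro tendsto_powr tendsto_const tendsto_ident_at) auto
    then show "((\<lambda>b. ennreal (b powr p)) \<longlongrightarrow> ennreal (\<bar>l\<bar> powr p)) (at_left \<bar>l\<bar>)"
      by (rule tendsto_ennrealI)
    have "\<forall>\<^sub>F b in at_left \<bar>l\<bar>. b \<in> {0<..<\<bar>l\<bar>}"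
      using False by (intro eventually_at_leftI) auto
    then show "\<forall>\<^sub>F b in at_left \<bar>l\<bar>. ennreal (b powr p) \<le> liminf (\<lambda>n. ennreal (G (t n * \<bar>c n\<bar>) / G (t n)))"
      by eventually_elim (auto intro: step)
  qed auto
qed simp

text \<open>For h = \<delta> z the Jacobian \<delta>^N cancels against |h|^(-N), so the kernel is
  invariant and the domain becomes the unit ball. At z = 0 both weights are 0, by the convention on
  division by zero.\<close>

lemma energy_scaling:
  fixes v :: "'a::euclidean_space \<Rightarrow> real" and \<Gamma> :: "real \<Rightarrow> real"
  assumes [measurable]: "v \<in> borel_measurable borel" "\<Gamma> \<in> borel_measurable borel" and \<delta>: "0 < \<delta>"
  shows "(\<integral>\<^sup>+h. ennreal (\<Gamma> ((v (x + h) - v x) / norm h powr s)) *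
        (ennreal (1 / norm h ^ DIM('a)) * indicator (ball 0 \<delta>) h) \<partial>lborel)
    = (\<integral>\<^sup>+z. ennreal (\<Gamma> ((v (x + \<delta> *\<^sub>R z) - v x) / (\<delta> * norm z) powr s)) *
        (ennreal (1 / norm z ^ DIM('a)) * indicator (ball 0 1) z) \<partial>lborel)"
    (is "(\<integral>\<^sup>+h. ?f h \<partial>lborel) = (\<integral>\<^sup>+z. ?g z \<partial>lborel)")
proof -
  define f where "f h = ?f h" for h
  have [measurable]: "f \<in> borel_measurable borel" unfolding f_def by measurable
  have "(\<integral>\<^sup>+h. f h \<partial>lborel) = ennreal (\<bar>\<delta>\<bar> ^ DIM('a)) * (\<integral>\<^sup>+z. f (0 + \<delta> *\<^sub>R z) \<partial>lborel)"
    using \<delta> by (intro nn_integral_lborel_affine) auto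
  also have "\<dots> = (\<integral>\<^sup>+z. ennreal (\<delta> ^ DIM('a)) * f (\<delta> *\<^sub>R z) \<partial>lborel)"
    using \<delta> by (simp add: nn_integral_cmult)
  also have "\<dots> = (\<integral>\<^sup>+z. ?g z \<partial>lborel)"
  proof (rule nn_integral_cong)
    fix z :: 'a
    have i: "indicator (ball 0 \<delta>) (\<delta> *\<^sub>R z) = (indicator (ball 0 1) z :: ennreal)"
      using \<delta> by (auto simp: indicator_def)
    have q: "ennreal (\<delta> ^ DIM('a)) * ennreal (1 / norm (\<delta> *\<^sub>R z) ^ DIM('a)) = ennreal (1 / norm z ^ DIM('a))"
      using \<delta> by (subst ennreal_mult'[symmetric]) (auto simp: power_mult_distrib)
    have n: "norm (\<delta> *\<^sub>R z) = \<delta> * norm z" using \<delta> by simp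
    have "ennreal (\<delta> ^ DIM('a)) * f (\<delta> *\<^sub>R z)
      = ennreal (\<Gamma> ((v (x + \<delta> *\<^sub>R z) - v x) / norm (\<delta> *\<^sub>R z) powr s)) *
        ((ennreal (\<delta> ^ DIM('a)) * ennreal (1 / norm (\<delta> *\<^sub>R z) ^ DIM('a))) * indicator (ball 0 \<delta>) (\<delta> *\<^sub>R z))"
      unfolding f_def by (simp only: mult_ac)
    then show "ennreal (\<delta> ^ DIM('a)) * f (\<delta> *\<^sub>R z) = ?g z" unfolding q i unfolding n .
  qed
  finally show ?thesis unfolding f_def .
qed

lemma gradient_energy_le:
  fixes v :: "'a::euclidean_space \<Rightarrow> real" and G :: "real \<Rightarrow> real"
  assumes mono: "mono_on {0..} G" and G0: "G 0 = 0" and pos: "\<And>t. 0 < t \<Longrightarrow> 0 < G t"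
    and rv: "\<And>c. 0 < c \<Longrightarrow> ((\<lambda>t. G (c * t) / G t) \<longlongrightarrow> c powr p) (at_right 0)"
    and \<Gamma>: "(\<lambda>t. G \<bar>t\<bar>) \<in> borel_measurable borel" and [measurable]: "v \<in> borel_measurable borel"
    and s: "0 < s" "s < 1" and p: "0 < p"
    and \<delta>: "\<And>n. 0 < \<delta> n" "\<delta> \<longlonglongrightarrow> 0"
    and D: "\<And>x. linear (D x)" "\<And>x z. (\<lambda>n. (v (x + \<delta> n *\<^sub>R z) - v x) / \<delta> n) \<longlonglongrightarrow> D x z"
    and E: "\<And>n. (\<integral>\<^sup>+x. \<integral>\<^sup>+h. ennreal (G \<bar>(v (x + h) - v x) / norm h powr s\<bar>) *
        (ennreal (1 / norm h ^ DIM('a)) * indicator (ball 0 (\<delta> n)) h) \<partial>lborel \<partial>lborel)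
      \<le> ennreal M * ennreal (G (\<delta> n powr (1 - s)))"
  shows "(\<integral>\<^sup>+x. \<integral>\<^sup>+z. ennreal (\<bar>D x z\<bar> powr p) * indicator (ball 0 1) z \<partial>lborel \<partial>lborel) \<le> ennreal M"
proof -
  define \<Gamma> where "\<Gamma> = (\<lambda>t. G \<bar>t\<bar>)"
  have [measurable]: "\<Gamma> \<in> borel_measurable borel" using \<Gamma> by (simp add: \<Gamma>_def)
  \<comment> \<open>The scale at which the hypothesis normalises the energy; \<open>arg\<close>
    below shows that the argument of \<open>G\<close> is exactly \<open>T n\<close> times a
    convergent sequence.\<close>
  define T where "T n = \<delta> n powr (1 - s)" for n
  have T: "0 < T n" for n using \<delta>(1)[of n] by (simp add: T_def)
  have T0: "T \<longlonglongrightarrow> 0"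
  proof -
    have "(\<lambda>n. \<delta> n powr (1 - s)) \<longlonglongrightarrow> 0 powr (1 - s)"
      using \<delta> s by (intro tendsto_powr' tendsto_const) (auto simp: less_imp_le)
    then show ?thesis by (simp add: T_def[abs_def])
  qed
  define F where "F n x z = ennreal (\<Gamma> ((v (x + \<delta> n *\<^sub>R z) - v x) / (\<delta> n * norm z) powr s)) *
        (ennreal (1 / norm z ^ DIM('a)) * indicator (ball 0 1) z) / ennreal (G (T n))" for n x z
  have [measurable]: "(\<lambda>z. F n (f z) (g z)) \<in> borel_measurable N"
    if [measurable]: "f \<in> measurable N borel" "g \<in> measurable N borel" for f g n and N :: "'c measure"
    unfolding F_def by measurable
  have ptw: "ennreal (\<bar>D x z\<bar> powr p) * indicator (ball 0 1) z \<le> liminf (\<lambda>n. F n x z)" for x z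
  proof (cases "z \<in> ball 0 1 \<and> z \<noteq> 0")
    case True
    then have z: "0 < norm z" "norm z < 1" by auto
    define c where "c n = (v (x + \<delta> n *\<^sub>R z) - v x) / \<delta> n / norm z powr s" for n
    have c: "c \<longlonglongrightarrow> D x z / norm z powr s"
      unfolding c_def using z by (intro tendsto_divide D(2) tendsto_const) auto
    have arg: "\<bar>(v (x + \<delta> n *\<^sub>R z) - v x) / (\<delta> n * norm z) powr s\<bar> = T n * \<bar>c n\<bar>" for n
    proof -
      have "T n = \<delta> n / \<delta> n powr s" unfolding T_def using \<delta>(1)[of n] by (simp add: powr_diff)
      then show ?thesis
        unfolding c_def using \<delta>(1)[of n] z by (simp add: powr_mult abs_mult)
    qed
    \<comment> \<open>In the unit ball |z|^s \<le> 1, so dropping this weight weakens the bound in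
      the right direction; likewise 1 \<le> |z|^(-N) further down.\<close>
    have "\<bar>D x z\<bar> powr p \<le> \<bar>D x z / norm z powr s\<bar> powr p"
    proof (rule powr_mono2)
      have "norm z powr s \<le> 1" using z s by (intro powr_le1) auto
      then show "\<bar>D x z\<bar> \<le> \<bar>D x z / norm z powr s\<bar>"
        using z by (simp add: pos_le_divide_eq mult_left_le)
    qed (use p in auto)
    then have "ennreal (\<bar>D x z\<bar> powr p) \<le> ennreal (\<bar>D x z / norm z powr s\<bar> powr p)" by (rule ennreal_leI)
    also have "\<dots> \<le> liminf (\<lambda>n. ennreal (G (T n * \<bar>c n\<bar>) / G (T n)))"
      by (rule regvar_liminf_ge[OF mono pos rv T T0 c])
    also have "\<dots> \<le> liminf (\<lambda>n. F n x z)"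
    proof (intro Liminf_mono always_eventually allI)
      fix n
      have "norm z ^ DIM('a) \<le> 1" using z by (intro power_le_one) auto
      moreover have pz: "0 < norm z ^ DIM('a)" using z by (intro zero_less_power)
      ultimately have "1 \<le> 1 / norm z ^ DIM('a)" unfolding le_divide_eq_1_pos[OF pz] by blast
      then have le: "1 \<le> ennreal (1 / norm z ^ DIM('a))"
        using ennreal_leI[of 1 "1 / norm z ^ DIM('a)"] by (simp only: ennreal_1)
      have le': "1 \<le> ennreal (1 / norm z ^ DIM('a)) * indicator (ball 0 1) z"
        unfolding indicator_eq_1_iff[THEN iffD2, OF conjunct1[OF True]] mult_1_right by (rule le)
      have "0 \<le> G (T n * \<bar>c n\<bar>)"
      proof (cases "c n = 0")
        case True
        then show ?thesis using G0 by simp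
      next
        case False
        then show ?thesis using pos[of "T n * \<bar>c n\<bar>"] T[of n] by (simp add: less_imp_le)
      qed
      then have "ennreal (G (T n * \<bar>c n\<bar>) / G (T n)) = ennreal (G (T n * \<bar>c n\<bar>)) * 1 / ennreal (G (T n))"
        using pos[OF T] by (simp add: divide_ennreal)
      also have "\<dots> \<le> F n x z"
        unfolding F_def \<Gamma>_def arg by (intro divide_right_mono_ennreal mult_left_mono le') simp
      finally show "ennreal (G (T n * \<bar>c n\<bar>) / G (T n)) \<le> F n x z" .
    qed
    finally show ?thesis using True by simp
  next
    case False
    \<comment> \<open>Outside the ball the indicator vanishes. At z = 0 division by zero makes
      \<open>F n x z\<close> equal to 0, which is harmless because D x 0 = 0.\<close>
    then have "ennreal (\<bar>D x z\<bar> powr p) * indicator (ball 0 1) z = 0"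
      using linear_0[OF D(1)] by auto
    then show ?thesis by (simp only: zero_le)
  qed
  have "(\<integral>\<^sup>+x. \<integral>\<^sup>+z. ennreal (\<bar>D x z\<bar> powr p) * indicator (ball 0 1) z \<partial>lborel \<partial>lborel)
    \<le> (\<integral>\<^sup>+x. \<integral>\<^sup>+z. liminf (\<lambda>n. F n x z) \<partial>lborel \<partial>lborel)"
    by (intro nn_integral_mono ptw)
  also have "\<dots> \<le> (\<integral>\<^sup>+x. liminf (\<lambda>n. \<integral>\<^sup>+z. F n x z \<partial>lborel) \<partial>lborel)"
    by (intro nn_integral_mono nn_integral_liminf) measurable
  also have "\<dots> \<le> liminf (\<lambda>n. \<integral>\<^sup>+x. \<integral>\<^sup>+z. F n x z \<partial>lborel \<partial>lborel)"
    by (intro nn_integral_liminf) measurable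
  also have "\<dots> \<le> liminf (\<lambda>n. ennreal M)"
  proof (intro Liminf_mono always_eventually allI)
    fix n
    have "(\<integral>\<^sup>+x. \<integral>\<^sup>+z. F n x z \<partial>lborel \<partial>lborel)
      = (\<integral>\<^sup>+x. \<integral>\<^sup>+z. ennreal (\<Gamma> ((v (x + \<delta> n *\<^sub>R z) - v x) / (\<delta> n * norm z) powr s)) *
        (ennreal (1 / norm z ^ DIM('a)) * indicator (ball 0 1) z) \<partial>lborel \<partial>lborel) / ennreal (G (T n))"
      unfolding F_def by (simp add: nn_integral_divide)
    also have "\<dots> = (\<integral>\<^sup>+x. \<integral>\<^sup>+h. ennreal (\<Gamma> ((v (x + h) - v x) / norm h powr s)) *
        (ennreal (1 / norm h ^ DIM('a)) * indicator (ball 0 (\<delta> n)) h) \<partial>lborel \<partial>lborel) / ennreal (G (T n))"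
      using \<delta>(1) by (simp add: energy_scaling)
    also have "\<dots> \<le> ennreal M * ennreal (G (T n)) / ennreal (G (T n))"
      unfolding T_def \<Gamma>_def by (intro divide_right_mono_ennreal E)
    also have "\<dots> = ennreal M"
      using pos[OF T[of n]] by (simp add: ennreal_mult_divide_eq)
    finally show "(\<integral>\<^sup>+x. \<integral>\<^sup>+z. F n x z \<partial>lborel \<partial>lborel) \<le> ennreal M" .
  qed
  also have "\<dots> = ennreal M" by (simp add: Liminf_const)
  finally show ?thesis .
qed

text \<open>Averaging \<open>D x e = 2 (D x (e/2 + z) - D x z)\<close> over \<open>|z| < 1/4\<close> keeps both arguments in the unit ball.\<close>

lemma directional_energy_le:
  fixes D :: "'a::euclidean_space \<Rightarrow> 'a \<Rightarrow> real" and e :: 'a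
  assumes p: "0 < p" and M: "0 \<le> M" and D: "\<And>x. linear (D x)"
    and Dm [measurable]: "\<And>v. (\<lambda>x. D x v) \<in> borel_measurable borel" and e: "norm e \<le> 1"
    and E: "(\<integral>\<^sup>+x. \<integral>\<^sup>+z. ennreal (\<bar>D x z\<bar> powr p) * indicator (ball 0 1) z \<partial>lborel \<partial>lborel) \<le> ennreal M"
  shows "(\<integral>\<^sup>+x. ennreal (\<bar>D x e\<bar> powr p) \<partial>lborel)
    \<le> ennreal (2 * 4 powr p * M / measure lborel (ball (0::'a) (1/4)))"
proof -
  define V where "V = measure lborel (ball (0::'a) (1/4))"
  have V: "0 < V" unfolding V_def by (rule content_ball_pos) auto
  have eV: "emeasure lborel (ball (0::'a) (1/4)) = ennreal V"
    unfolding V_def by (intro emeasure_eq_ennreal_measure) (use emeasure_lborel_ball_finite[of "0::'a" "1/4"] in auto)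
  let ?h = "\<lambda>x z. ennreal (\<bar>D x z\<bar> powr p) * indicator (ball 0 1) z"
  \<comment> \<open>Measurability is known for each fixed direction; expanding \<open>z\<close> in
    the finite basis makes \<open>D\<close> jointly measurable.\<close>
  have D_eq: "D x z = (\<Sum>b\<in>Basis. (z \<bullet> b) * D x b)" for x z
    by (subst (1) euclidean_representation[of z, symmetric]) (simp add: linear_sum[OF D] linear_scale[OF D])
  have [measurable]: "(\<lambda>z. D (f z) (g z)) \<in> borel_measurable N"
    if [measurable]: "f \<in> measurable N borel" "g \<in> measurable N borel" for f g and N :: "'c measure"
    by (subst D_eq) measurable
  have pt: "ennreal V * ennreal (\<bar>D x e\<bar> powr p) \<le> ennreal (2 * 4 powr p) * (\<integral>\<^sup>+z. ?h x z \<partial>lborel)" for x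
  proof -
    have "ennreal V * ennreal (\<bar>D x e\<bar> powr p) = (\<integral>\<^sup>+z. ennreal (\<bar>D x e\<bar> powr p) * indicator (ball (0::'a) (1/4)) z \<partial>lborel)"
      by (subst nn_integral_cmult_indicator) (auto simp: eV mult.commute)
    also have "\<dots> \<le> (\<integral>\<^sup>+z. ennreal (4 powr p) * (?h x ((1/2) *\<^sub>R e + z) + ?h x z) \<partial>lborel)"
    proof (intro nn_integral_mono)
      fix z :: 'a
      show "ennreal (\<bar>D x e\<bar> powr p) * indicator (ball 0 (1/4)) z
        \<le> ennreal (4 powr p) * (?h x ((1/2) *\<^sub>R e + z) + ?h x z)"
      proof (cases "z \<in> ball 0 (1/4)")
        case True
        then have z: "z \<in> ball 0 1" by auto
        have ze: "(1/2) *\<^sub>R e + z \<in> ball 0 1"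
          using True e norm_triangle_ineq[of "(1/2) *\<^sub>R e" z] by simp
        let ?a = "\<bar>D x ((1/2) *\<^sub>R e + z)\<bar>" and ?b = "\<bar>D x z\<bar>"
        have "\<bar>D x e\<bar> \<le> 2 * (?a + ?b)"
          unfolding linear_add[OF D] linear_scale[OF D] by (simp add: abs_if)
        then have "\<bar>D x e\<bar> powr p \<le> (2 * (?a + ?b)) powr p" using p by (intro powr_mono2) auto
        also have "\<dots> = 2 powr p * (?a + ?b) powr p" by (rule powr_mult)
        also have "\<dots> \<le> 2 powr p * (2 powr p * (?a powr p + ?b powr p))"
          using p by (intro mult_left_mono powr_add_le) auto
        also have "\<dots> = 4 powr p * (?a powr p + ?b powr p)"
          using powr_mult[of 2 2 p] by simp
        finally have "ennreal (\<bar>D x e\<bar> powr p) \<le> ennreal (4 powr p) * (ennreal (?a powr p) + ennreal (?b powr p))"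
          by (simp add: ennreal_leI flip: ennreal_plus ennreal_mult)
        then show ?thesis using True z ze by simp
      qed simp
    qed
    also have "\<dots> = ennreal (4 powr p) * ((\<integral>\<^sup>+z. ?h x ((1/2) *\<^sub>R e + z) \<partial>lborel) + (\<integral>\<^sup>+z. ?h x z \<partial>lborel))"
      by (simp add: nn_integral_cmult nn_integral_add)
    also have "(\<integral>\<^sup>+z. ?h x ((1/2) *\<^sub>R e + z) \<partial>lborel) = (\<integral>\<^sup>+z. ?h x z \<partial>lborel)"
      by (rule nn_integral_lborel_shift) measurable
    also have "ennreal (4 powr p) * ((\<integral>\<^sup>+z. ?h x z \<partial>lborel) + (\<integral>\<^sup>+z. ?h x z \<partial>lborel))
      = ennreal (2 * 4 powr p) * (\<integral>\<^sup>+z. ?h x z \<partial>lborel)"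
      by (simp add: ennreal_mult' mult_2[symmetric] mult_ac)
    finally show ?thesis .
  qed
  let ?X = "\<integral>\<^sup>+x. ennreal (\<bar>D x e\<bar> powr p) \<partial>lborel"
  have "ennreal V * ?X \<le> (\<integral>\<^sup>+x. ennreal (2 * 4 powr p) * (\<integral>\<^sup>+z. ?h x z \<partial>lborel) \<partial>lborel)"
    by (subst nn_integral_cmult[symmetric]) (auto intro!: nn_integral_mono pt)
  also have "\<dots> = ennreal (2 * 4 powr p) * (\<integral>\<^sup>+x. \<integral>\<^sup>+z. ?h x z \<partial>lborel \<partial>lborel)"
    by (rule nn_integral_cmult) measurable
  also have "\<dots> \<le> ennreal (2 * 4 powr p) * ennreal M" by (intro mult_left_mono E) simp
  also have "\<dots> = ennreal (2 * 4 powr p * M)" by (simp add: ennreal_mult')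
  finally have le: "ennreal V * ?X \<le> ennreal (2 * 4 powr p * M)" .
  show ?thesis
  \<comment> \<open>Division by \<open>V\<close> takes place in the reals; an infinite integral
    would contradict the finite bound because V > 0.\<close>
  proof (cases ?X rule: ennreal_cases)
    case (real r)
    then have "V * r \<le> 2 * 4 powr p * M"
      using le V M by (simp flip: ennreal_mult')
    then show ?thesis unfolding real(2) V_def[symmetric] using V
      by (intro ennreal_leI) (simp add: pos_le_divide_eq mult.commute)
  next
    case top
    then show ?thesis using le V by (simp add: ennreal_mult_top top_unique)
  qed
qed

subsection \<open>Weak derivatives\<close>

text \<open>A weighted mean stays as close to \<open>c\<close> as the values on the support do. It
  is used with c the value at the centre, for convergence, and with c = 0, for domination.\<close>

lemma mollifier_average:
  fixes h :: "'a::euclidean_space \<Rightarrow> real"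
  assumes \<rho>: "mollifier r \<rho> \<rho>'" and [measurable]: "h \<in> borel_measurable borel"
    and h: "\<And>t. norm t \<le> r \<Longrightarrow> \<bar>h t - c\<bar> \<le> \<epsilon>" and \<epsilon>: "0 \<le> \<epsilon>"
  shows "\<bar>(\<integral>t. \<rho> t * h t \<partial>lborel) - c\<bar> \<le> \<epsilon>"
proof -
  have C: "C1c \<rho> \<rho>'" and \<rho>0: "\<And>x. 0 \<le> \<rho> x" and I: "(\<integral>x. \<rho> x \<partial>lborel) = 1"
    and supp: "\<And>x. \<rho> x \<noteq> 0 \<Longrightarrow> norm x \<le> r"
    using \<rho> by (auto simp: mollifier_def)
  note [measurable] = C1c_borel[OF C]
  note int\<rho> = C1c_integrable(1)[OF C]
  have bd: "\<bar>\<rho> t * (h t - c)\<bar> \<le> \<rho> t * \<epsilon>" for t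
    using supp[of t] h[of t] \<rho>0[of t] \<epsilon> by (cases "\<rho> t = 0") (auto simp: abs_mult intro!: mult_left_mono)
  have int: "integrable lborel (\<lambda>t. \<rho> t * (h t - c))"
  proof (rule Bochner_Integration.integrable_bound[where f="\<lambda>t. \<rho> t * \<epsilon>"])
    show "AE t in lborel. norm (\<rho> t * (h t - c)) \<le> norm (\<rho> t * \<epsilon>)"
      using order_trans[OF bd abs_ge_self] by simp
  qed (use int\<rho> in auto)
  have "(\<integral>t. \<rho> t * h t \<partial>lborel) = (\<integral>t. \<rho> t * (h t - c) + \<rho> t * c \<partial>lborel)"
    by (intro Bochner_Integration.integral_cong) (auto simp: algebra_simps)
  also have "\<dots> = (\<integral>t. \<rho> t * (h t - c) \<partial>lborel) + c"
    using int int\<rho> I by simp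
  finally have "\<bar>(\<integral>t. \<rho> t * h t \<partial>lborel) - c\<bar> = \<bar>\<integral>t. \<rho> t * (h t - c) \<partial>lborel\<bar>" by simp
  also have "\<dots> \<le> (\<integral>t. \<bar>\<rho> t * (h t - c)\<bar> \<partial>lborel)" by (rule integral_abs_bound)
  also have "\<dots> \<le> (\<integral>t. \<rho> t * \<epsilon> \<partial>lborel)"
    using int int\<rho> bd by (intro integral_mono) auto
  also have "\<dots> = \<epsilon>" using I by simp
  finally show ?thesis .
qed

text \<open>Fubini makes \<open>y\<close> the outer variable. For fixed \<open>y\<close> only the
  smooth factors \<rho> and \<phi> depend on \<open>x\<close>, so integration by parts is available
  although \<open>u\<close> is rough; x = y + t then gives the stated form.\<close>

lemma conv_integral_by_parts:
  fixes u :: "'a::euclidean_space \<Rightarrow> real"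
  assumes u: "loc_int u" and \<rho>: "C1c \<rho> \<rho>'" and \<phi>: "C1c \<phi> \<phi>'"
  shows "(\<integral>x. conv (\<lambda>x. \<rho>' x i) u x * \<phi> x \<partial>lborel)
    = - (\<integral>y. u y * (\<integral>t. \<rho> t * \<phi>' (y + t) i \<partial>lborel) \<partial>lborel)"
proof -
  obtain R where R: "\<And>x. \<rho> x \<noteq> 0 \<Longrightarrow> norm x \<le> R" using \<rho> by (auto simp: C1c_def)
  obtain B where B: "0 \<le> B" "\<And>x. \<bar>\<rho>' x i\<bar> \<le> B * indicator (cball 0 R) x"
    using C1c_bounds[OF \<rho> R] by metis
  obtain S where S: "\<And>x. \<phi> x \<noteq> 0 \<Longrightarrow> norm x \<le> S" using \<phi> by (auto simp: C1c_def)
  obtain A where A: "0 \<le> A" "\<And>x. \<bar>\<phi> x\<bar> \<le> A * indicator (cball 0 S) x"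
    using C1c_bounds[OF \<phi> S] by metis
  note [measurable] = C1c_borel[OF \<rho>] C1c_borel[OF \<phi>]
  have [measurable]: "u \<in> borel_measurable borel" using u by (simp add: loc_int_def)
  \<comment> \<open>The supports of the kernel and of \<phi> confine \<open>y\<close> to the ball of
    radius R + S, so the integrand is dominated by a product of an integrable function of
    \<open>x\<close> and one of \<open>y\<close>.\<close>
  define w where "w y = B * (indicator (cball 0 (R + S)) y * u y)" for y
  have [measurable]: "w \<in> borel_measurable borel" unfolding w_def by measurable
  have w: "integrable lborel w" unfolding w_def using u by (auto simp: loc_int_def)
  define k where "k x y = \<rho>' (x - y) i * u y * \<phi> x" for x y
  have [measurable]: "(\<lambda>z. k (f z) (g z)) \<in> borel_measurable N"
    if [measurable]: "f \<in> measurable N borel" "g \<in> measurable N borel" for f g and N :: "'c measure"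
    unfolding k_def by measurable
  have k_le: "\<bar>k x y\<bar> \<le> \<bar>(A * indicator (cball 0 S) x) * w y\<bar>" for x y
  proof (cases "norm x \<le> S \<and> norm (x - y) \<le> R")
    case True
    then have "norm y \<le> R + S" using norm_triangle_ineq4[of x "x - y"] by simp
    moreover have "\<bar>\<rho>' (x - y) i\<bar> \<le> B" "\<bar>\<phi> x\<bar> \<le> A" using B(2)[of "x - y"] A(2)[of x] True by auto
    moreover have "\<bar>\<rho>' (x - y) i\<bar> * \<bar>u y\<bar> * \<bar>\<phi> x\<bar> \<le> B * \<bar>u y\<bar> * A"
      using calculation A(1) B(1) by (intro mult_mono) auto
    ultimately show ?thesis
      using True A(1) B(1) unfolding k_def w_def abs_mult by (simp add: mult_ac)
  next
    case False
    then have "k x y = 0" using B(2)[of "x - y"] A(2)[of x] by (auto simp: k_def)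
    then show ?thesis by simp
  qed
  have "integrable (lborel \<Otimes>\<^sub>M lborel) (\<lambda>(x, y). (A * indicator (cball 0 S) x) * w y)"
  proof (rule lborel_pair.Fubini_integrable)
    show "integrable lborel (\<lambda>x. \<integral>y. norm (case (x, y) of (x, y) \<Rightarrow> (A * indicator (cball 0 S) x) * w y) \<partial>lborel)"
      using integrable_indicator_cball[of "A * (\<integral>y. \<bar>w y\<bar> \<partial>lborel)" S] A(1) by (simp add: abs_mult mult_ac)
  qed (use w in auto)
  then have "integrable (lborel \<Otimes>\<^sub>M lborel) (\<lambda>(x, y). k x y)"
    by (rule Bochner_Integration.integrable_bound) (use k_le in auto)
  note F = lborel_pair.Fubini_integral[OF this]
  have "(\<integral>x. conv (\<lambda>x. \<rho>' x i) u x * \<phi> x \<partial>lborel) = (\<integral>x. \<integral>y. k x y \<partial>lborel \<partial>lborel)"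
    unfolding conv_def k_def by simp
  also have "\<dots> = (\<integral>y. \<integral>x. k x y \<partial>lborel \<partial>lborel)" using F by simp
  also have "\<dots> = (\<integral>y. - (u y * (\<integral>t. \<rho> t * \<phi>' (y + t) i \<partial>lborel)) \<partial>lborel)"
  proof (rule Bochner_Integration.integral_cong[OF refl])
    fix y
    have "(\<integral>x. k x y \<partial>lborel) = u y * (\<integral>x. \<rho>' (x - y) i * \<phi> x \<partial>lborel)"
      unfolding k_def by (subst integral_mult_right_zero[symmetric]) (simp only: mult_ac)
    also have "(\<integral>x. \<rho>' (x - y) i * \<phi> x \<partial>lborel) = - (\<integral>x. \<rho> (x - y) * \<phi>' x i \<partial>lborel)"
      by (rule C1c_integration_by_parts[OF C1c_shift[OF \<rho>] \<phi>])
    also have "(\<integral>x. \<rho> (x - y) * \<phi>' x i \<partial>lborel) = (\<integral>t. \<rho> t * \<phi>' (y + t) i \<partial>lborel)"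
      using integral_lborel_shift(1)[of "\<lambda>x. \<rho> (x - y) * \<phi>' x i" y] by (simp add: add.commute)
    finally show "(\<integral>x. k x y \<partial>lborel) = - (u y * (\<integral>t. \<rho> t * \<phi>' (y + t) i \<partial>lborel))" by simp
  qed
  finally show ?thesis by simp
qed

text \<open>After integrating by parts, the mollifier acts on the continuous derivative of \<phi>,
  and these averages converge pointwise. As the scales are at most 1, their supports stay in the
  ball of radius S + 1, where \<open>u\<close> is integrable.\<close>

lemma conv_weak_limit:
  fixes u :: "'a::euclidean_space \<Rightarrow> real"
  assumes u: "loc_int u" and \<phi>: "C1c \<phi> \<phi>'"
    and \<rho>: "\<And>n. mollifier (1 / Suc n) (\<rho> n) (\<rho>' n)"
  shows "(\<lambda>n. \<integral>x. conv (\<lambda>x. \<rho>' n x i) u x * \<phi> x \<partial>lborel) \<longlonglongrightarrow> - (\<integral>x. u x * \<phi>' x i \<partial>lborel)"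
proof -
  obtain S where S: "\<And>x. \<phi> x \<noteq> 0 \<Longrightarrow> norm x \<le> S" using \<phi> by (auto simp: C1c_def)
  obtain A where A: "0 \<le> A" "\<And>x. \<bar>\<phi>' x i\<bar> \<le> A * indicator (cball 0 S) x"
    using C1c_bounds[OF \<phi> S] by metis
  have C: "C1c (\<rho> n) (\<rho>' n)" for n using \<rho> by (simp add: mollifier_def)
  note [measurable] = C1c_borel[OF C] C1c_borel[OF \<phi>]
  have [measurable]: "u \<in> borel_measurable borel" using u by (simp add: loc_int_def)
  define \<psi> where "\<psi> n y = (\<integral>t. \<rho> n t * \<phi>' (y + t) i \<partial>lborel)" for n y
  have [measurable]: "\<psi> n \<in> borel_measurable borel" for n unfolding \<psi>_def by measurable
  have "(\<lambda>n. \<integral>y. u y * \<psi> n y \<partial>lborel) \<longlonglongrightarrow> (\<integral>y. u y * \<phi>' y i \<partial>lborel)"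
  proof (rule integral_dominated_convergence[where w="\<lambda>y. A * norm (indicator (cball 0 (S + 1)) y * u y)"])
    show "integrable lborel (\<lambda>y. A * norm (indicator (cball 0 (S + 1)) y * u y))"
      using u by (intro integrable_mult_right integrable_norm) (auto simp: loc_int_def)
    show "AE y in lborel. (\<lambda>n. u y * \<psi> n y) \<longlonglongrightarrow> u y * \<phi>' y i"
    proof (intro always_eventually allI tendsto_mult tendsto_const)
      fix y
      show "(\<lambda>n. \<psi> n y) \<longlonglongrightarrow> \<phi>' y i"
      proof (rule LIMSEQ_I)
        fix r :: real assume r: "0 < r"
        have "continuous_on UNIV (\<lambda>x. \<phi>' x i)" using \<phi> by (simp add: C1c_def)
        then have "isCont (\<lambda>x. \<phi>' x i) y" by (simp add: continuous_on_eq_continuous_at)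
        then obtain d where d: "0 < d" "\<And>x. dist x y < d \<Longrightarrow> dist (\<phi>' x i) (\<phi>' y i) < r / 2"
          using r unfolding continuous_at_eps_delta by (metis half_gt_zero)
        obtain N where N: "1 / real (Suc N) < d" using d(1) nat_approx_posE by blast
        show "\<exists>no. \<forall>n\<ge>no. norm (\<psi> n y - \<phi>' y i) < r"
        proof (intro exI[of _ N] allI impI)
          fix n assume n: "N \<le> n"
          have "1 / real (Suc n) \<le> 1 / real (Suc N)" using n by (intro divide_left_mono) auto
          then have "1 / real (Suc n) < d" using N by linarith
          then have "\<bar>\<psi> n y - \<phi>' y i\<bar> \<le> r / 2"
            unfolding \<psi>_def using r d(2)[of "y + t" for t]
            by (intro mollifier_average[OF \<rho>]) (measurable, auto simp: dist_norm less_imp_le)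
          then show "norm (\<psi> n y - \<phi>' y i) < r" using r by simp
        qed
      qed
    qed
    show "AE y in lborel. norm (u y * \<psi> n y) \<le> A * norm (indicator (cball 0 (S + 1)) y * u y)" for n
    proof (intro always_eventually allI)
      fix y
      have "\<bar>\<psi> n y - 0\<bar> \<le> A * indicator (cball 0 (S + 1)) y"
        unfolding \<psi>_def
      proof (rule mollifier_average[OF \<rho>])
        fix t :: 'a assume t: "norm t \<le> 1 / real (Suc n)"
        have "1 / real (Suc n) \<le> 1" by simp
        then have t1: "norm t \<le> 1" using t by linarith
        show "\<bar>\<phi>' (y + t) i - 0\<bar> \<le> A * indicator (cball 0 (S + 1)) y"
        proof (cases "norm y \<le> S + 1")
          case True
          then show ?thesis using le_mult_indicatorD[OF A(2) A(1)] by simp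
        next
          case False
          then have "S < norm (y + t)" using t1 norm_triangle_ineq4[of "y + t" t] by simp
          then show ?thesis using A(2)[of "y + t"] A(1) by simp
        qed
      qed (use A in auto)
      then have "\<bar>u y\<bar> * \<bar>\<psi> n y\<bar> \<le> \<bar>u y\<bar> * (A * indicator (cball 0 (S + 1)) y)"
        by (intro mult_left_mono) auto
      then show "norm (u y * \<psi> n y) \<le> A * norm (indicator (cball 0 (S + 1)) y * u y)"
        by (simp add: abs_mult mult_ac)
    qed
  qed measurable
  then have "(\<lambda>n. - (\<integral>y. u y * \<psi> n y \<partial>lborel)) \<longlonglongrightarrow> - (\<integral>y. u y * \<phi>' y i \<partial>lborel)"
    by (rule tendsto_minus)
  then show ?thesis
    by (simp add: conv_integral_by_parts[OF u C \<phi>] \<psi>_def)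
qed

section \<open>Consequences of the hypotheses on \<open>G\<close> and \<open>u\<close>\<close>

text \<open>Jensen is applied to signed difference quotients, whereas \<open>G\<close> is convex on
  the half line only. Monotonicity carries the triangle inequality through \<open>G\<close>.\<close>

lemma orlicz_abs_convex:
  assumes "orlicz G"
  shows "convex_on UNIV (\<lambda>t. G \<bar>t\<bar>)"
proof (rule convex_onI)
  have c: "convex_on {0..} G" and m: "mono_on {0..} G" using assms by (auto simp: orlicz_def)
  fix t x y :: real assume t: "0 < t" "t < 1"
  have "G \<bar>(1 - t) *\<^sub>R x + t *\<^sub>R y\<bar> \<le> G ((1 - t) *\<^sub>R \<bar>x\<bar> + t *\<^sub>R \<bar>y\<bar>)"
  proof (rule mono_onD[OF m])
    have "\<bar>(1 - t) * x + t * y\<bar> \<le> \<bar>(1 - t) * x\<bar> + \<bar>t * y\<bar>" by (rule abs_triangle_ineq)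
    then show "\<bar>(1 - t) *\<^sub>R x + t *\<^sub>R y\<bar> \<le> (1 - t) *\<^sub>R \<bar>x\<bar> + t *\<^sub>R \<bar>y\<bar>"
      using t by (simp add: abs_mult)
  qed (use t in auto)
  also have "\<dots> \<le> (1 - t) * G \<bar>x\<bar> + t * G \<bar>y\<bar>"
    using t by (intro convex_onD[OF c]) auto
  finally show "G \<bar>(1 - t) *\<^sub>R x + t *\<^sub>R y\<bar> \<le> (1 - t) * G \<bar>x\<bar> + t * G \<bar>y\<bar>" .
qed simp

lemma orlicz_abs_borel:
  assumes "orlicz G"
  shows "(\<lambda>t. G \<bar>t\<bar>) \<in> borel_measurable borel"
proof (rule borel_measurable_continuous_onI)
  have "continuous_on {0..} G" using assms by (simp add: orlicz_def)
  then show "continuous_on UNIV (\<lambda>t. G \<bar>t\<bar>)"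
    by (rule continuous_on_compose2) (auto intro!: continuous_intros)
qed

lemma hypH_index_gt_1:
  assumes "hypH G p"
  shows "1 < p"
proof (rule ccontr)
  assume "\<not> 1 < p"
  obtain c where c: "0 < c" "\<And>t. 0 < t \<Longrightarrow> c \<le> G t / t powr p" using assms by (auto simp: hypH_def)
  have "((\<lambda>t. G t / t) \<longlongrightarrow> 0) (at_right 0)" using assms by (auto simp: hypH_def orlicz_def)
  then have "\<forall>\<^sub>F t in at_right 0. G t / t < c" using c(1) by (rule order_tendstoD)
  moreover have "\<forall>\<^sub>F t in at_right (0::real). t \<in> {0<..<1}"
    by (intro eventually_at_rightI) auto
  ultimately have "\<forall>\<^sub>F t in at_right (0::real). False"
  proof eventually_elim
    case (elim t)
    have "t powr 1 \<le> t powr p" using elim \<open>\<not> 1 < p\<close> by (intro powr_mono') auto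
    then have "c * t \<le> c * t powr p" using elim c(1) by simp
    also have "\<dots> \<le> G t" using c(2)[of t] elim by (simp add: pos_le_divide_eq)
    finally show False using elim by (simp add: pos_divide_less_eq)
  qed
  then show False by (simp add: trivial_limit_at_right_real)
qed

text \<open>The lower bound on G t / t^p holds for all t > 0, large and small, so finiteness of the
  integral of \<open>G |u|\<close> carries over to the p-th power.\<close>

lemma LG_imp_powr_nn_integral:
  fixes u :: "'a::euclidean_space \<Rightarrow> real"
  assumes G: "hypH G p" and u: "LG G u"
  shows "(\<integral>\<^sup>+x. ennreal (\<bar>u x\<bar> powr p) \<partial>lebesgue) < \<infinity>"
proof -
  obtain c where c: "0 < c" "\<And>t. 0 < t \<Longrightarrow> c \<le> G t / t powr p" using G by (auto simp: hypH_def)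
  have "G 0 = 0" using G by (simp add: hypH_def orlicz_def)
  have le: "\<bar>t\<bar> powr p \<le> 1 / c * G \<bar>t\<bar>" for t
  proof (cases "t = 0")
    case False
    then show ?thesis using c(2)[of "\<bar>t\<bar>"] c(1) by (simp add: field_simps)
  qed (simp add: \<open>G 0 = 0\<close>)
  have [measurable]: "u \<in> borel_measurable lebesgue" using u by (simp add: LG_def)
  have Gm: "(\<lambda>x. G \<bar>u x\<bar>) \<in> borel_measurable lebesgue"
    using measurable_compose[OF _ orlicz_abs_borel, of u lebesgue G] G by (simp add: hypH_def)
  have "(\<integral>\<^sup>+x. ennreal (\<bar>u x\<bar> powr p) \<partial>lebesgue) \<le> (\<integral>\<^sup>+x. ennreal (1 / c) * ennreal (G \<bar>u x\<bar>) \<partial>lebesgue)"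
    using c(1) le by (intro nn_integral_mono) (simp add: ennreal_leI flip: ennreal_mult')
  also have "\<dots> = ennreal (1 / c) * (\<integral>\<^sup>+x. ennreal (G \<bar>u x\<bar>) \<partial>lebesgue)"
    using Gm by (intro nn_integral_cmult) auto
  also have "\<dots> < \<infinity>" using u by (auto simp: LG_def ennreal_mult_less_top)
  finally show ?thesis .
qed

lemma loc_int_of_powr:
  fixes v :: "'a::euclidean_space \<Rightarrow> real"
  assumes [measurable]: "v \<in> borel_measurable borel" and p: "1 \<le> p"
    and v: "integrable lborel (\<lambda>x. \<bar>v x\<bar> powr p)"
  shows "loc_int v"
  unfolding loc_int_def
proof (intro conjI allI)
  fix R
  show "integrable lborel (\<lambda>x. indicator (cball 0 R) x * v x)"
  proof (rule Bochner_Integration.integrable_bound[where f="\<lambda>x. 1 * indicator (cball 0 R) x + \<bar>v x\<bar> powr p"])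
    show "integrable lborel (\<lambda>x. 1 * indicator (cball 0 R) x + \<bar>v x\<bar> powr p)"
      by (intro Bochner_Integration.integrable_add integrable_indicator_cball v)
    show "AE x in lborel. norm (indicator (cball 0 R) x * v x) \<le> norm (1 * indicator (cball 0 R) x + \<bar>v x\<bar> powr p)"
      using le_one_plus_powr[of "\<bar>v x\<bar>" p for x] p by (auto simp: indicator_def)
  qed measurable
qed measurable

text \<open>Puts the energy of the theorem into the form with increments h = y - x. Nonnegative
  integrals do not change under completion, and almost everywhere equality is used once in
  \<open>x\<close> and, for each good \<open>x\<close>, once in \<open>y\<close>.\<close>

lemma gagliardo_energy_lborel:
  fixes u v :: "'a::euclidean_space \<Rightarrow> real"
  assumes G: "orlicz G" and v [measurable]: "v \<in> borel_measurable borel" and uv: "AE x in lborel. u x = v x"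
  shows "(\<integral>\<^sup>+x. (\<integral>\<^sup>+y\<in>ball x \<delta>.
      ennreal (G (\<bar>u x - u y\<bar> / dist x y powr s) / dist x y ^ DIM('a)) \<partial>lebesgue) \<partial>lebesgue)
    = (\<integral>\<^sup>+x. \<integral>\<^sup>+h. ennreal (G \<bar>(v (x + h) - v x) / norm h powr s\<bar>) *
        (ennreal (1 / norm h ^ DIM('a)) * indicator (ball 0 \<delta>) h) \<partial>lborel \<partial>lborel)"
proof -
  define \<Gamma> where "\<Gamma> = (\<lambda>t. G \<bar>t\<bar>)"
  have [measurable]: "\<Gamma> \<in> borel_measurable borel" using orlicz_abs_borel[OF G] by (simp add: \<Gamma>_def)
  define k where "k x h = ennreal (\<Gamma> ((v (x + h) - v x) / norm h powr s)) *
        (ennreal (1 / norm h ^ DIM('a)) * indicator (ball 0 \<delta>) h)" for x h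
  have G0: "0 \<le> G t" if "0 \<le> t" for t using G that by (simp add: orlicz_def)
  have eq: "ennreal (G (\<bar>v x - v y\<bar> / dist x y powr s) / dist x y ^ DIM('a)) * indicator (ball x \<delta>) y = k x (- x + y)" for x y
  proof -
    have "\<bar>(v y - v x) / norm (y - x) powr s\<bar> = \<bar>v x - v y\<bar> / dist x y powr s"
      by (simp add: dist_norm norm_minus_commute abs_minus_commute)
    moreover have "indicator (ball 0 \<delta>) (- x + y) = (indicator (ball x \<delta>) y :: ennreal)"
      by (simp add: indicator_def dist_norm norm_minus_commute)
    moreover have "ennreal (G (\<bar>v x - v y\<bar> / dist x y powr s) / dist x y ^ DIM('a)) =
      ennreal (G (\<bar>v x - v y\<bar> / dist x y powr s)) * ennreal (1 / dist x y ^ DIM('a))"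
      using G0 by (simp flip: ennreal_mult)
    ultimately show ?thesis
      by (simp add: k_def \<Gamma>_def mult.assoc dist_norm norm_minus_commute abs_minus_commute[of "v y" "v x"])
  qed
  have [measurable]: "(\<lambda>h. k x h) \<in> borel_measurable borel" for x unfolding k_def by measurable
  have "(\<integral>\<^sup>+x. (\<integral>\<^sup>+y\<in>ball x \<delta>.
      ennreal (G (\<bar>u x - u y\<bar> / dist x y powr s) / dist x y ^ DIM('a)) \<partial>lebesgue) \<partial>lebesgue)
    = (\<integral>\<^sup>+x. (\<integral>\<^sup>+y\<in>ball x \<delta>.
      ennreal (G (\<bar>u x - u y\<bar> / dist x y powr s) / dist x y ^ DIM('a)) \<partial>lborel) \<partial>lborel)"
    by (simp add: nn_integral_completion)
  also have "\<dots> = (\<integral>\<^sup>+x. \<integral>\<^sup>+y. k x (- x + y) \<partial>lborel \<partial>lborel)"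
  proof (rule nn_integral_cong_AE)
    show "AE x in lborel. (\<integral>\<^sup>+y\<in>ball x \<delta>. ennreal (G (\<bar>u x - u y\<bar> / dist x y powr s) / dist x y ^ DIM('a)) \<partial>lborel)
      = (\<integral>\<^sup>+y. k x (- x + y) \<partial>lborel)"
      using uv
    proof eventually_elim
      case (elim x)
      from uv have "AE y in lborel. ennreal (G (\<bar>u x - u y\<bar> / dist x y powr s) / dist x y ^ DIM('a)) *
        indicator (ball x \<delta>) y = k x (- x + y)"
        by eventually_elim (simp only: elim eq)
      then show ?case by (rule nn_integral_cong_AE)
    qed
  qed
  also have "\<dots> = (\<integral>\<^sup>+x. \<integral>\<^sup>+h. k x h \<partial>lborel \<partial>lborel)"
    by (intro nn_integral_cong nn_integral_lborel_shift) measurable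
  finally show ?thesis by (simp add: k_def \<Gamma>_def)
qed

text \<open>Any finite \<open>c\<close> above the lower limit is undercut arbitrarily close to 0,
  though not necessarily at all small arguments; one such point is picked below each
  \<open>1 / Suc n\<close>.\<close>

lemma Liminf_finite_sequence:
  fixes f :: "real \<Rightarrow> ennreal"
  assumes "Liminf (at_right 0) f < \<infinity>"
  obtains M \<delta> where "0 \<le> M" "\<And>n. 0 < \<delta> n" "\<And>n. \<delta> n \<le> 1" "\<delta> \<longlonglongrightarrow> 0" "\<And>n::nat. f (\<delta> n) \<le> ennreal M"
proof -
  obtain c where c: "Liminf (at_right 0) f < c" "c < \<infinity>" using dense[OF assms] by auto
  then obtain M where M: "c = ennreal M" "0 \<le> M" by (cases c rule: ennreal_cases) auto
  have "\<not> (\<forall>\<^sub>F x in at_right 0. c \<le> f x)"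
    using Liminf_bounded[of c f "at_right 0"] c(1) by (auto simp: not_le)
  then have fr: "\<exists>\<^sub>F x in at_right 0. f x < c" by (simp add: frequently_def not_less)
  have "\<exists>d. 0 < d \<and> d < 1 / real (Suc n) \<and> f d < c" for n
  proof -
    have "\<forall>\<^sub>F x in at_right 0. x \<in> {0<..<1 / real (Suc n)}"
      by (intro eventually_at_rightI) auto
    from frequently_eventually_frequently[OF fr this] show ?thesis
      by (auto dest: frequently_ex)
  qed
  then obtain \<delta> where \<delta>: "\<And>n. 0 < \<delta> n" "\<And>n. \<delta> n < 1 / real (Suc n)" "\<And>n. f (\<delta> n) < c" by metis
  show thesis
  proof (rule that[of M \<delta>])
    show "\<delta> n \<le> 1" for n
    proof -
      have "1 / real (Suc n) \<le> 1" by simp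
      then show ?thesis using \<delta>(2)[of n] by linarith
    qed
    show "\<delta> \<longlonglongrightarrow> 0"
      by (rule tendsto_sandwich[OF _ _ tendsto_const LIMSEQ_Suc[OF lim_1_over_n]])
        (use \<delta> in \<open>auto intro!: always_eventually simp: less_imp_le\<close>)
    show "f (\<delta> n) \<le> ennreal M" for n using \<delta>(3)[of n] M(1) by simp
  qed (use M \<delta> in auto)
qed

text \<open>A test function comes with its own continuous derivative; uniqueness of derivatives
  identifies it with the given one.\<close>

lemma test_fun_C1c:
  assumes "test_fun \<phi>" "\<forall>x. (\<phi> has_derivative \<phi>' x) (at x)"
  shows "C1c \<phi> \<phi>'"
  unfolding C1c_def
proof (intro conjI allI)
  show d: "(\<phi> has_derivative \<phi>' x) (at x)" for x using assms by simp
  have "Ck (Suc 0) \<phi>" using assms(1) unfolding test_fun_def by blast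
  then obtain f' where f': "\<And>x. (\<phi> has_derivative f' x) (at x)" "\<And>v. continuous_on UNIV (\<lambda>x. f' x v)"
    by auto
  have "f' = \<phi>'" using has_derivative_unique[OF f'(1) d] by auto
  then show "continuous_on UNIV (\<lambda>x. \<phi>' x v)" for v using f'(2) by simp
  have "bounded (closure {x. \<phi> x \<noteq> 0})" using assms(1) by (simp add: test_fun_def compact_imp_bounded)
  then obtain R where "\<forall>x\<in>closure {x. \<phi> x \<noteq> 0}. norm x \<le> R" by (auto simp: bounded_iff)
  then show "\<exists>R. \<forall>x. \<phi> x \<noteq> 0 \<longrightarrow> norm x \<le> R"
    using closure_subset[of "{x. \<phi> x \<noteq> 0}"] by (intro exI[of _ R]) auto
qed

section \<open>From uniform gradient bounds to a weak derivative\<close>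

lemma bounded_gradients_weak_derivative:
  fixes v :: "'a::euclidean_space \<Rightarrow> real"
  assumes p: "1 < p" and C: "0 \<le> C" and v: "loc_int v"
    and bnd: "\<And>r \<rho> \<rho>'. mollifier r \<rho> \<rho>' \<Longrightarrow>
      (\<integral>\<^sup>+x. ennreal (\<bar>conv (\<lambda>x. \<rho>' x i) v x\<bar> powr p) \<partial>lborel) \<le> ennreal C"
  obtains g where "g \<in> borel_measurable borel" "(\<integral>\<^sup>+x. ennreal (\<bar>g x\<bar> powr p) \<partial>lborel) \<le> ennreal C"
    "\<And>\<phi> \<phi>'. C1c \<phi> \<phi>' \<Longrightarrow> (\<integral>x. v x * \<phi>' x i \<partial>lborel) = - (\<integral>x. g x * \<phi> x \<partial>lborel)"
proof -
  have [measurable]: "v \<in> borel_measurable borel" using v by (simp add: loc_int_def)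
  define K where "K n = {f. \<exists>\<rho> \<rho>'. mollifier (1 / Suc n) \<rho> \<rho>' \<and> f = conv (\<lambda>x. \<rho>' x i) v}" for n
  \<comment> \<open>A strictly positive integrable density turns Lebesgue measure into a finite
    measure with the same null sets. Capping it at 1 lets the bound by \<open>C\<close> carry over
    to the new measure; almost everywhere convergence is carried back.\<close>
  obtain w0 :: "'a \<Rightarrow> ennreal" where w0 [measurable]: "w0 \<in> borel_measurable lborel"
    and w0': "integral\<^sup>N lborel w0 \<noteq> \<infinity>" "\<And>x. 0 < w0 x"
    using sigma_finite_measure.Ex_finite_integrable_function[OF sigma_finite_lborel] by auto
  define w where "w x = min (w0 x) 1" for x
  have w [measurable]: "w \<in> borel_measurable lborel" unfolding w_def by measurable
  have w1: "w x \<le> 1" "0 < w x" for x using w0'(2) by (auto simp: w_def)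
  let ?M = "density lborel w"
  interpret M: finite_measure ?M
  proof
    have "emeasure ?M (space ?M) = (\<integral>\<^sup>+x. w x \<partial>lborel)" by (simp add: emeasure_density)
    also have "\<dots> \<le> integral\<^sup>N lborel w0" by (intro nn_integral_mono) (simp add: w_def)
    finally show "emeasure ?M (space ?M) \<noteq> \<infinity>" using w0'(1) by (auto simp: top_unique)
  qed
  have K_meas: "f \<in> borel_measurable borel" if f: "f \<in> K n" for f n
  proof -
    obtain \<rho> \<rho>' where \<rho>: "mollifier (1 / Suc n) \<rho> \<rho>'" "f = conv (\<lambda>x. \<rho>' x i) v"
      using f unfolding K_def by blast
    then have "(\<lambda>x. \<rho>' x i) \<in> borel_measurable borel" by (intro C1c_borel) (auto simp: mollifier_def)
    then show ?thesis unfolding \<rho>(2) by measurable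
  qed
  have K_bnd: "(\<integral>\<^sup>+x. ennreal (\<bar>f x\<bar> powr p) \<partial>lborel) \<le> ennreal C" if "f \<in> K n" for f n
    using that bnd unfolding K_def by blast
  have K_bndM: "(\<integral>\<^sup>+x. ennreal (\<bar>f x\<bar> powr p) \<partial>?M) \<le> ennreal C" if "f \<in> K n" for f n
  proof -
    note [measurable] = K_meas[OF that]
    have "(\<integral>\<^sup>+x. ennreal (\<bar>f x\<bar> powr p) \<partial>?M) = (\<integral>\<^sup>+x. w x * ennreal (\<bar>f x\<bar> powr p) \<partial>lborel)"
      by (rule nn_integral_density) measurable
    also have "\<dots> \<le> (\<integral>\<^sup>+x. 1 * ennreal (\<bar>f x\<bar> powr p) \<partial>lborel)"
      using w1 by (intro nn_integral_mono mult_right_mono) auto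
    also have "\<dots> \<le> ennreal C" using K_bnd[OF that] by simp
    finally show ?thesis .
  qed
  have "\<exists>u g. (\<forall>n. u n \<in> K n) \<and> g \<in> borel_measurable ?M \<and> (AE x in ?M. (\<lambda>n. u n x) \<longlonglongrightarrow> g x)"
  proof (rule M.minimizing_sequence_AE_convergent[OF p, of K C])
    show "decseq K"
    proof (intro decseq_SucI subsetI)
      fix n f assume "f \<in> K (Suc n)"
      then obtain \<rho> \<rho>' where \<rho>: "mollifier (1 / Suc (Suc n)) \<rho> \<rho>'" "f = conv (\<lambda>x. \<rho>' x i) v"
        unfolding K_def by blast
      have "mollifier (1 / Suc n) \<rho> \<rho>'"
        by (rule mollifier_mono[OF \<rho>(1)]) (intro divide_left_mono, auto)
      then show "f \<in> K n" using \<rho>(2) unfolding K_def by blast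
    qed
    show "K n \<noteq> {}" for n
    proof -
      obtain \<rho> :: "'a \<Rightarrow> real" and \<rho>' where "mollifier (1 / Suc n) \<rho> \<rho>'"
        using mollifier_exists[of "1 / Suc n"] by auto
      then show ?thesis unfolding K_def by blast
    qed
    show "(\<lambda>x. (f x + g x) / 2) \<in> K n" if fg: "f \<in> K n" "g \<in> K n" for n f g
    proof -
      obtain \<rho> \<rho>' where \<rho>: "mollifier (1 / Suc n) \<rho> \<rho>'" "f = conv (\<lambda>x. \<rho>' x i) v"
        using fg(1) unfolding K_def by blast
      obtain \<sigma> \<sigma>' where \<sigma>: "mollifier (1 / Suc n) \<sigma> \<sigma>'" "g = conv (\<lambda>x. \<sigma>' x i) v"
        using fg(2) unfolding K_def by blast
      have "C1c \<rho> \<rho>'" "C1c \<sigma> \<sigma>'" using \<rho> \<sigma> by (auto simp: mollifier_def)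
      note I = C1c_conv_integrable(2)[OF v this(1)] C1c_conv_integrable(2)[OF v this(2)]
      have "conv (\<lambda>x. (\<rho>' x i + \<sigma>' x i) / 2) v x = (f x + g x) / 2" for x
      proof -
        have "conv (\<lambda>x. (\<rho>' x i + \<sigma>' x i) / 2) v x
          = (\<integral>y. (\<rho>' (x - y) i * v y + \<sigma>' (x - y) i * v y) / 2 \<partial>lborel)"
          unfolding conv_def by (intro Bochner_Integration.integral_cong) (auto simp: algebra_simps)
        also have "\<dots> = (f x + g x) / 2" unfolding \<rho>(2) \<sigma>(2) conv_def using I by simp
        finally show ?thesis .
      qed
      then have "(\<lambda>x. (f x + g x) / 2) = conv (\<lambda>x. (\<rho>' x i + \<sigma>' x i) / 2) v" by auto
      then show ?thesis using mollifier_midpoint[OF \<rho>(1) \<sigma>(1)] unfolding K_def by blast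
    qed
    show "f \<in> borel_measurable ?M" if "f \<in> K n" for f n using K_meas[OF that] by simp
    then show "integrable ?M (\<lambda>x. \<bar>f x\<bar> powr p)" if "f \<in> K n" for f n
      using that by (intro integrable_powr_of_nn_integral_le[OF _ K_bndM]) auto
    show "(\<integral>x. \<bar>f x\<bar> powr p \<partial>?M) \<le> C" if "f \<in> K n" for f n
      using integral_real_bounded[OF C K_bndM[OF that]] .
  qed blast
  then obtain u g where u: "\<And>n. u n \<in> K n" and g: "g \<in> borel_measurable ?M"
    and lim: "AE x in ?M. (\<lambda>n. u n x) \<longlonglongrightarrow> g x" by blast
  have g [measurable]: "g \<in> borel_measurable borel" using g by simp
  have um [measurable]: "u n \<in> borel_measurable borel" for n using K_meas[OF u] .
  have lim: "AE x in lborel. (\<lambda>n. u n x) \<longlonglongrightarrow> g x"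
    using lim w1(2) by (simp add: AE_density)
  have "\<exists>\<rho> \<rho>'. \<forall>n. mollifier (1 / Suc n) (\<rho> n) (\<rho>' n) \<and> u n = conv (\<lambda>x. \<rho>' n x i) v"
    using u unfolding K_def by (simp add: choice_iff') metis
  then obtain \<rho> \<rho>' where \<rho>: "\<And>n. mollifier (1 / Suc n) (\<rho> n) (\<rho>' n)" "\<And>n. u n = conv (\<lambda>x. \<rho>' n x i) v"
    by blast
  show thesis
  proof (rule that[of g])
    show "(\<integral>\<^sup>+x. ennreal (\<bar>g x\<bar> powr p) \<partial>lborel) \<le> ennreal C"
      by (rule Lp_bounded_AE_limit[OF p _ _ K_bnd[OF u] lim]) measurable
    fix \<phi> :: "'a \<Rightarrow> real" and \<phi>' assume \<phi>: "C1c \<phi> \<phi>'"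
    note [measurable] = C1c_borel[OF \<phi>]
    obtain S where S: "\<And>x. \<phi> x \<noteq> 0 \<Longrightarrow> norm x \<le> S" using \<phi> by (auto simp: C1c_def)
    obtain A where A: "\<And>x. \<bar>\<phi> x\<bar> \<le> A * indicator (cball 0 S) x"
      using C1c_bounds[OF \<phi> S] by metis
    have "(\<lambda>n. \<integral>x. u n x * \<phi> x \<partial>lborel) \<longlonglongrightarrow> (\<integral>x. g x * \<phi> x \<partial>lborel)"
      using emeasure_lborel_cball_finite[of "0::'a" S]
      by (intro Lp_bounded_AE_limit_weak[OF p C _ _ _ _ K_bnd[OF u] lim _ A]) auto
    moreover have "(\<lambda>n. \<integral>x. u n x * \<phi> x \<partial>lborel) \<longlonglongrightarrow> - (\<integral>x. v x * \<phi>' x i \<partial>lborel)"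
      unfolding \<rho>(2) by (rule conv_weak_limit[OF v \<phi> \<rho>(1)])
    ultimately have "(\<integral>x. g x * \<phi> x \<partial>lborel) = - (\<integral>x. v x * \<phi>' x i \<partial>lborel)" by (rule LIMSEQ_unique)
    then show "(\<integral>x. v x * \<phi>' x i \<partial>lborel) = - (\<integral>x. g x * \<phi> x \<partial>lborel)" by simp
  qed (rule g)
qed

theorem theorem1p4:
  fixes G :: "real \<Rightarrow> real" and p s :: real and u :: "'a::euclidean_space \<Rightarrow> real"
  assumes "0 < s" "s < 1"
    and "hypH G p"
    and "LG G u"
    and "Liminf (at_right 0)
          (\<lambda>\<delta>. (\<integral>\<^sup>+x. (\<integral>\<^sup>+y\<in>ball x \<delta>.
                 ennreal (G (\<bar>u x - u y\<bar> / dist x y powr s) / dist x y ^ DIM('a)) \<partial>lebesgue) \<partial>lebesgue)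
               / ennreal (G (\<delta> powr (1 - s)))) < \<infinity>"
  shows "W1p p u"
proof -
  have orl: "orlicz G" and rv: "regvar0 G p" using assms(3) by (auto simp: hypH_def)
  have mono: "mono_on {0..} G" and G0: "G 0 = 0" and Gnn: "\<And>t. 0 \<le> t \<Longrightarrow> 0 \<le> G t"
    using orl by (auto simp: orlicz_def)
  have pos: "0 < G t" if "0 < t" for t using rv that by (simp add: regvar0_def)
  have lim: "((\<lambda>t. G (c * t) / G t) \<longlongrightarrow> c powr p) (at_right 0)" if "0 < c" for c
    using rv that by (simp add: regvar0_def)
  have p: "1 < p" by (rule hypH_index_gt_1[OF assms(3)])
  have um [measurable]: "u \<in> borel_measurable lebesgue" using assms(4) by (simp add: LG_def)
  \<comment> \<open>Convolutions and Tonelli's theorem are applied to this Borel version; the result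
    returns to \<open>u\<close> at the end, since weak derivatives see \<open>u\<close> only up to
    null sets.\<close>
  obtain v where v: "v \<in> borel_measurable lborel" and uv: "AE x in lborel. u x = v x"
    using completion_ex_borel_measurable_real[OF um] by blast
  have vb [measurable]: "v \<in> borel_measurable borel" using v by simp
  have uvl: "AE x in lebesgue. u x = v x" using uv by (rule AE_completion)

  have up: "(\<integral>\<^sup>+x. ennreal (\<bar>u x\<bar> powr p) \<partial>lebesgue) < \<infinity>"
    by (rule LG_imp_powr_nn_integral[OF assms(3,4)])
  have ui: "integrable lebesgue (\<lambda>x. \<bar>u x\<bar> powr p)"
    using up by (intro integrableI_bounded) auto
  have "integrable lebesgue (\<lambda>x. \<bar>v x\<bar> powr p)"
    using uvl by (intro integrable_cong_AE_imp[OF ui]) (auto intro: measurable_completion)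
  then have "integrable lborel (\<lambda>x. \<bar>v x\<bar> powr p)"
    by (subst (asm) integrable_completion) auto
  then have vloc: "loc_int v" using p by (intro loc_int_of_powr[of v p]) auto

  obtain M \<delta> where M: "0 \<le> M" and \<delta>: "\<And>n::nat. 0 < \<delta> n" "\<And>n. \<delta> n \<le> 1" "\<delta> \<longlonglongrightarrow> 0"
    and E: "\<And>n. (\<integral>\<^sup>+x. (\<integral>\<^sup>+y\<in>ball x (\<delta> n).
                 ennreal (G (\<bar>u x - u y\<bar> / dist x y powr s) / dist x y ^ DIM('a)) \<partial>lebesgue) \<partial>lebesgue)
               / ennreal (G (\<delta> n powr (1 - s))) \<le> ennreal M"
    by (rule Liminf_finite_sequence[OF assms(5)]) (rule that)
  define en where "en f n = (\<integral>\<^sup>+x. \<integral>\<^sup>+h. ennreal (G \<bar>(f (x + h) - f x) / norm h powr s\<bar>) *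
        (ennreal (1 / norm h ^ DIM('a)) * indicator (ball 0 (\<delta> n)) h) \<partial>lborel \<partial>lborel)"
    for f :: "'a \<Rightarrow> real" and n
  have Ev: "en v n \<le> ennreal M * ennreal (G (\<delta> n powr (1 - s)))" for n
  proof -
    let ?g = "ennreal (G (\<delta> n powr (1 - s)))"
    \<comment> \<open>The normalising factor is positive and finite, so the division by it in the
      hypothesis can be undone in the extended reals.\<close>
    have g: "?g \<noteq> 0" "?g \<noteq> top" using pos[of "\<delta> n powr (1 - s)"] \<delta>(1)[of n] by auto
    have "en v n / ?g \<le> ennreal M"
      using E[of n] unfolding en_def gagliardo_energy_lborel[OF orl vb uv] .
    then have "en v n / ?g * ?g \<le> ennreal M * ?g" by (rule mult_right_mono) simp
    moreover have "en v n / ?g * ?g = en v n"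
      using g by (simp add: ennreal_divide_times ennreal_divide_self less_top)
    ultimately show ?thesis by simp
  qed
  \<comment> \<open>The constant of \<open>directional_energy_le\<close> for unit vectors; it
    involves neither the radius nor the kernel of the mollifier.\<close>
  define C where "C = 2 * 4 powr p * M / measure lborel (ball (0::'a) (1/4))"
  have C: "0 \<le> C" using M by (simp add: C_def)
  have grad: "(\<integral>\<^sup>+x. ennreal (\<bar>conv (\<lambda>x. \<rho>' x i) v x\<bar> powr p) \<partial>lborel) \<le> ennreal C"
    if \<rho>: "mollifier r \<rho> \<rho>'" and i: "i \<in> Basis" for r \<rho> \<rho>' i
  proof -
    have \<rho>C: "C1c \<rho> \<rho>'" using \<rho> by (simp add: mollifier_def)
    note [measurable] = C1c_borel[OF \<rho>C]
    define D where "D x z = conv (\<lambda>x. \<rho>' x z) v x" for x z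
    have linD: "linear (D x)" for x unfolding D_def by (rule conv_derivative_linear[OF vloc \<rho>C])
    have En: "en (conv \<rho> v) n \<le> ennreal M * ennreal (G (\<delta> n powr (1 - s)))" for n
    proof -
      have "en (conv \<rho> v) n \<le> en v n"
        unfolding en_def
        by (rule energy_conv_le[OF \<rho> vloc orlicz_abs_convex[OF orl] _ orlicz_abs_borel[OF orl]])
          (auto intro!: Gnn, measurable)
      with Ev[of n] show ?thesis by (rule order_trans[rotated])
    qed
    have "(\<integral>\<^sup>+x. \<integral>\<^sup>+z. ennreal (\<bar>D x z\<bar> powr p) * indicator (ball 0 1) z \<partial>lborel \<partial>lborel) \<le> ennreal M"
    proof (rule gradient_energy_le[OF mono G0 pos lim orlicz_abs_borel[OF orl] _ assms(1,2) _ \<delta>(1,3)])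
      show "linear (D x)" for x by (rule linD)
      show "(\<lambda>n. (conv \<rho> v (x + \<delta> n *\<^sub>R z) - conv \<rho> v x) / \<delta> n) \<longlonglongrightarrow> D x z" for x z
        unfolding D_def by (rule conv_difference_quotient_tendsto[OF vloc \<rho>C \<delta>])
      show "(\<integral>\<^sup>+x. \<integral>\<^sup>+h. ennreal (G \<bar>(conv \<rho> v (x + h) - conv \<rho> v x) / norm h powr s\<bar>) *
        (ennreal (1 / norm h ^ DIM('a)) * indicator (ball 0 (\<delta> n)) h) \<partial>lborel \<partial>lborel)
        \<le> ennreal M * ennreal (G (\<delta> n powr (1 - s)))" for n
        using En[of n] unfolding en_def .
    qed (use p in auto)
    then have "(\<integral>\<^sup>+x. ennreal (\<bar>D x i\<bar> powr p) \<partial>lborel) \<le> ennreal C"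
      unfolding C_def using p M i by (intro directional_energy_le linD) (auto simp: D_def)
    then show ?thesis by (simp add: D_def)
  qed
  show ?thesis
    unfolding W1p_def
  proof (intro conjI ballI)
    show "Lp p u" unfolding Lp_def using um ui by simp
    fix i :: 'a assume i: "i \<in> Basis"
    obtain g where g [measurable]: "g \<in> borel_measurable borel"
      and gC: "(\<integral>\<^sup>+x. ennreal (\<bar>g x\<bar> powr p) \<partial>lborel) \<le> ennreal C"
      and parts: "\<And>\<phi> \<phi>'. C1c \<phi> \<phi>' \<Longrightarrow> (\<integral>x. v x * \<phi>' x i \<partial>lborel) = - (\<integral>x. g x * \<phi> x \<partial>lborel)"
      by (rule bounded_gradients_weak_derivative[OF p C vloc, of i]) (erule grad[OF _ i], rule that)
    show "\<exists>g. Lp p g \<and> (\<forall>\<phi> \<phi>'. test_fun \<phi> \<and> (\<forall>x. (\<phi> has_derivative \<phi>' x) (at x)) \<longrightarrow>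
           (\<integral>x. u x * \<phi>' x i \<partial>lebesgue) = - (\<integral>x. g x * \<phi> x \<partial>lebesgue))"
    proof (intro exI[of _ g] conjI allI impI)
      have "integrable lborel (\<lambda>x. \<bar>g x\<bar> powr p)"
        by (rule integrable_powr_of_nn_integral_le[OF _ gC]) simp
      then have "integrable lebesgue (\<lambda>x. \<bar>g x\<bar> powr p)" by (subst integrable_completion) auto
      then show "Lp p g" unfolding Lp_def by (auto intro: measurable_completion)
      fix \<phi> :: "'a \<Rightarrow> real" and \<phi>' assume "test_fun \<phi> \<and> (\<forall>x. (\<phi> has_derivative \<phi>' x) (at x))"
      then have \<phi>: "C1c \<phi> \<phi>'" by (intro test_fun_C1c) auto
      note [measurable] = C1c_borel[OF \<phi>]
      have "(\<integral>x. u x * \<phi>' x i \<partial>lebesgue) = (\<integral>x. v x * \<phi>' x i \<partial>lebesgue)"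
      proof (rule integral_cong_AE)
        have "(\<lambda>x. \<phi>' x i) \<in> borel_measurable lebesgue" by (rule measurable_completion) measurable
        with um show "(\<lambda>x. u x * \<phi>' x i) \<in> borel_measurable lebesgue" by (rule borel_measurable_times)
        show "(\<lambda>x. v x * \<phi>' x i) \<in> borel_measurable lebesgue" by (rule measurable_completion) measurable
        show "AE x in lebesgue. u x * \<phi>' x i = v x * \<phi>' x i" using uvl by eventually_elim simp
      qed
      also have "\<dots> = (\<integral>x. v x * \<phi>' x i \<partial>lborel)" by (rule integral_completion) measurable
      also have "\<dots> = - (\<integral>x. g x * \<phi> x \<partial>lborel)" by (rule parts[OF \<phi>])
      also have "(\<integral>x. g x * \<phi> x \<partial>lborel) = (\<integral>x. g x * \<phi> x \<partial>lebesgue)"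
        by (rule integral_completion[symmetric]) measurable
      finally show "(\<integral>x. u x * \<phi>' x i \<partial>lebesgue) = - (\<integral>x. g x * \<phi> x \<partial>lebesgue)" .
    qed
  qed
qed

end
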